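(* Let $(H,R)$ be a finite dimensional quasi-triangular Hopf algebra over a field $k$. Assume that $H$ is cosemisimple and unimodular. Let $\lambda$ be an integral of $H^*$ with $\langle\lambda,1_H\rangle=1$, and let $$e_R=\sum\left(R^2\rightharpoonup\lambda_{(1)}\right)\otimes\left(S^*\lambda_{(2)}\triangleleft R^1\right)\in H^*\otimes H^*.$$ Then the algebra $H_R^*=(H^*,\ast_R,\varepsilon)$ is semisimple and $e_R$ is a separable idempotent of it, i.e. 1. $\sum\left(R^2\rightharpoonup\lambda_{(1)}\right)\ast_R\left(S^*\lambda_{(2)}\triangleleft R^1\right)=\varepsilon$; 2. for all $f\in H^*$, $(f\otimes\varepsilon)\ast_Re_R=e_R\ast_R(\varepsilon\otimes f)$.
   Context: $H$ has coproduct $\Delta(h)=\sum h_{(1)}\otimes h_{(2)}$, counit $\varepsilon$ and antipode $S$; $S^*$ is the antipode of the dual Hopf algebra $H^*$, and $\sum\lambda_{(1)}\otimes\lambda_{(2)}$ is the coproduct of $\lambda$ in $H^*$, i.e. $\lambda(xy)=\sum\lambda_{(1)}(x)\lambda_{(2)}(y)$. Quasi-triangular: $R=\sum R^1\otimes R^2\in H\otimes H$ is invertible with $\sum R^1h_{(1)}\otimes R^2h_{(2)}=\sum h_{(2)}R^1\otimes h_{(1)}R^2$ for all $h\in H$, $(\Delta\otimes id)(R)=R^{13}R^{23}$, $(id\otimes\Delta)(R)=R^{13}R^{12}$. Left adjoint action: $h\cdot_{ad}a=\sum h_{(1)}aS(h_{(2)})$. Transmuted braided group $H_R$: the vector space $H$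 with coalgebra structure given by $\Delta_R(h)=\sum h_{(1)}S(R^2)\otimes R^1\cdot_{ad}h_{(2)}$ and counit $\varepsilon$. $H_R^*$ is the convolution algebra of the coalgebra $(H_R,\Delta_R,\varepsilon)$, with product $\ast_R$ and unit $\varepsilon$; on $H^*\otimes H^*$, $\ast_R$ denotes the componentwise product. Actions of $H$ on $H^*$: $(h\rightharpoonup f)(x)=f(xh)$, $(f\leftharpoonup h)(x)=f(hx)$, and the right coadjoint action $f\triangleleft h=\sum S(h_{(2)})\rightharpoonup f\leftharpoonup h_{(1)}$, i.e. $(f\triangleleft h)(x)=f(h\cdot_{ad}x)$ (the paper writes this action with a double harpoon). Unimodular means that left and right integrals of $H$ coincide. *)

theory Defs
  imports Complex_Main "HOL-Library.Poly_Mapping" "HOL-Library.Function_Algebras"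
begin

section \<open>Tensors\<close>

text \<open>
  A list of words \<open>[[x\<^sub>1, \<dots>, x\<^sub>n], [y\<^sub>1, \<dots>, y\<^sub>n], \<dots>]\<close> denotes the tensor
  \<open>x\<^sub>1 \<otimes> \<dots> \<otimes> x\<^sub>n + y\<^sub>1 \<otimes> \<dots> \<otimes> y\<^sub>n + \<dots>\<close>. Two such lists are identified when they agree in the
  free vector space on words modulo the subspace generated by the multilinearity relations,
  that is, in \<open>V \<otimes> \<dots> \<otimes> V\<close> (inside the tensor algebra of \<open>V\<close>). The space \<open>V\<close> is a subspace of a
  type with scalar multiplication \<open>s\<close>.
\<close>

definition formal_sum :: "'a list list \<Rightarrow> 'a list \<Rightarrow>\<^sub>0 'k::field" where
  "formal_sum ts = (\<Sum>w\<leftarrow>ts. Poly_Mapping.single w 1)"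

definition multilinear_relations ::
    "('k::field \<Rightarrow> 'a::ab_group_add \<Rightarrow> 'a) \<Rightarrow> 'a set \<Rightarrow> ('a list \<Rightarrow>\<^sub>0 'k) set" where
  "multilinear_relations s V =
     {Poly_Mapping.single (us @ [x + y] @ vs) 1
        - Poly_Mapping.single (us @ [x] @ vs) 1 - Poly_Mapping.single (us @ [y] @ vs) 1
      | us x y vs. set us \<subseteq> V \<and> x \<in> V \<and> y \<in> V \<and> set vs \<subseteq> V}
   \<union> {Poly_Mapping.single (us @ [s c x] @ vs) 1 - Poly_Mapping.single (us @ [x] @ vs) c
      | us c x vs. set us \<subseteq> V \<and> x \<in> V \<and> set vs \<subseteq> V}"

definition tensor_eq ::
    "('k::field \<Rightarrow> 'a::ab_group_add \<Rightarrow> 'a) \<Rightarrow> 'a set \<Rightarrow> 'a list list \<Rightarrow> 'a list list \<Rightarrow> bool" where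
  "tensor_eq s V ts us \<longleftrightarrow>
     formal_sum ts - formal_sum us
       \<in> module.span (\<lambda>c. Poly_Mapping.map ((*) c)) (multilinear_relations s V)"

text \<open>Elements of \<open>V \<otimes> V\<close> are usually given by lists of pairs.\<close>

definition pair_words :: "('a \<times> 'a) list \<Rightarrow> 'a list list" where
  "pair_words ts = [[a, b]. (a, b) \<leftarrow> ts]"

definition tensor_mult ::
    "('a \<Rightarrow> 'a \<Rightarrow> 'a) \<Rightarrow> ('a \<times> 'a) list \<Rightarrow> ('a \<times> 'a) list \<Rightarrow> ('a \<times> 'a) list" where
  "tensor_mult m ts us = [(m a c, m b d). (a, b) \<leftarrow> ts, (c, d) \<leftarrow> us]"


section \<open>Semisimple algebras\<close>

text \<open>An algebra is given by a subspace \<open>A\<close> of a type with scalar multiplication \<open>s\<close>,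
  a product \<open>m\<close> and a unit \<open>u\<close>.\<close>

definition unital_algebra ::
    "('k::field \<Rightarrow> 'a::ab_group_add \<Rightarrow> 'a) \<Rightarrow> 'a set \<Rightarrow> ('a \<Rightarrow> 'a \<Rightarrow> 'a) \<Rightarrow> 'a \<Rightarrow> bool" where
  "unital_algebra s A m u \<longleftrightarrow>
     module.subspace s A \<and> u \<in> A \<and> (\<forall>x\<in>A. \<forall>y\<in>A. m x y \<in> A) \<and>
     (\<forall>x\<in>A. \<forall>y\<in>A. \<forall>z\<in>A. m (x + y) z = m x z + m y z \<and> m x (y + z) = m x y + m x z) \<and>
     (\<forall>c. \<forall>x\<in>A. \<forall>y\<in>A. m (s c x) y = s c (m x y) \<and> m x (s c y) = s c (m x y)) \<and>
     (\<forall>x\<in>A. \<forall>y\<in>A. \<forall>z\<in>A. m (m x y) z = m x (m y z)) \<and>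
     (\<forall>x\<in>A. m u x = x \<and> m x u = x)"

definition left_ideal ::
    "('k::field \<Rightarrow> 'a::ab_group_add \<Rightarrow> 'a) \<Rightarrow> 'a set \<Rightarrow> ('a \<Rightarrow> 'a \<Rightarrow> 'a) \<Rightarrow> 'a set \<Rightarrow> bool" where
  "left_ideal s A m I \<longleftrightarrow>
     module.subspace s I \<and> I \<subseteq> A \<and> (\<forall>a\<in>A. \<forall>x\<in>I. m a x \<in> I)"

definition minimal_left_ideal ::
    "('k::field \<Rightarrow> 'a::ab_group_add \<Rightarrow> 'a) \<Rightarrow> 'a set \<Rightarrow> ('a \<Rightarrow> 'a \<Rightarrow> 'a) \<Rightarrow> 'a set \<Rightarrow> bool" where
  "minimal_left_ideal s A m I \<longleftrightarrow>
     left_ideal s A m I \<and> I \<noteq> {0} \<and>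
     (\<forall>J. left_ideal s A m J \<and> J \<subseteq> I \<longrightarrow> J = {0} \<or> J = I)"

text \<open>The regular left module is a sum of simple submodules.\<close>

definition semisimple_algebra ::
    "('k::field \<Rightarrow> 'a::ab_group_add \<Rightarrow> 'a) \<Rightarrow> 'a set \<Rightarrow> ('a \<Rightarrow> 'a \<Rightarrow> 'a) \<Rightarrow> 'a \<Rightarrow> bool" where
  "semisimple_algebra s A m u \<longleftrightarrow>
     unital_algebra s A m u \<and> module.span s (\<Union>{I. minimal_left_ideal s A m I}) = A"


section \<open>Hopf algebras\<close>

definition dual_scale :: "'k::field \<Rightarrow> ('h \<Rightarrow> 'k) \<Rightarrow> ('h \<Rightarrow> 'k)" where
  "dual_scale c f = (\<lambda>x. c * f x)"

text \<open>Convolution product with respect to a comultiplication \<open>D\<close>; for \<open>D = \<Delta>\<close> this is the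
  product of \<open>H\<^sup>*\<close>.\<close>

definition convolution ::
    "('h \<Rightarrow> ('h \<times> 'h) list) \<Rightarrow> ('h \<Rightarrow> 'k::field) \<Rightarrow> ('h \<Rightarrow> 'k) \<Rightarrow> ('h \<Rightarrow> 'k)" where
  "convolution D f g = (\<lambda>h. \<Sum>(a, b)\<leftarrow>D h. f a * g b)"

text \<open>
  The underlying algebra is the whole type \<open>'h\<close> (the class \<open>ring_1\<close> demands \<open>0 \<noteq> 1\<close>, which
  holds in every Hopf algebra because \<open>\<epsilon> 1 = 1\<close>). For each \<open>h\<close>, the list \<open>\<Delta> h\<close> of pairs
  \<open>(h\<^sub>1, h\<^sub>2)\<close> represents the coproduct of \<open>h\<close>, so that list comprehensions and list sums over
  \<open>\<Delta> h\<close> are Sweedler sums. Only the class of \<open>\<Delta> h\<close> in \<open>H \<otimes> H\<close> is constrained.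
\<close>

locale hopf_algebra = vector_space scale
  for scale :: "'k::field \<Rightarrow> 'h::ring_1 \<Rightarrow> 'h" (infixr \<open>*s\<close> 75) +
  fixes \<Delta> :: "'h \<Rightarrow> ('h \<times> 'h) list"
    and \<epsilon> :: "'h \<Rightarrow> 'k"
    and S :: "'h \<Rightarrow> 'h"
  assumes scale_mult_left: "(c *s x) * y = c *s (x * y)"
    and scale_mult_right: "x * (c *s y) = c *s (x * y)"
    and comult_add:
      "tensor_eq scale UNIV (pair_words (\<Delta> (x + y))) (pair_words (\<Delta> x) @ pair_words (\<Delta> y))"
    and comult_scale:
      "tensor_eq scale UNIV (pair_words (\<Delta> (c *s x))) [[c *s a, b]. (a, b) \<leftarrow> \<Delta> x]"
    and counit_linear: "Vector_Spaces.linear scale (*) \<epsilon>"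
    and coassoc:
      "tensor_eq scale UNIV [[c, d, b]. (a, b) \<leftarrow> \<Delta> h, (c, d) \<leftarrow> \<Delta> a]
                            [[a, c, d]. (a, b) \<leftarrow> \<Delta> h, (c, d) \<leftarrow> \<Delta> b]"
    and counit_left: "(\<Sum>(a, b)\<leftarrow>\<Delta> h. \<epsilon> a *s b) = h"
    and counit_right: "(\<Sum>(a, b)\<leftarrow>\<Delta> h. \<epsilon> b *s a) = h"
    and comult_mult:
      "tensor_eq scale UNIV (pair_words (\<Delta> (x * y))) (pair_words (tensor_mult (*) (\<Delta> x) (\<Delta> y)))"
    and comult_one: "tensor_eq scale UNIV (pair_words (\<Delta> 1)) [[1, 1]]"
    and counit_mult: "\<epsilon> (x * y) = \<epsilon> x * \<epsilon> y"
    and counit_one: "\<epsilon> 1 = 1"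
    and antipode_linear: "Vector_Spaces.linear scale scale S"
    and antipode_left: "(\<Sum>(a, b)\<leftarrow>\<Delta> h. S a * b) = \<epsilon> h *s 1"
    and antipode_right: "(\<Sum>(a, b)\<leftarrow>\<Delta> h. a * S b) = \<epsilon> h *s 1"
begin

definition finite_dimensional :: bool where
  "finite_dimensional \<longleftrightarrow> (\<exists>B. finite B \<and> span B = UNIV)"

definition subcoalgebra :: "'h set \<Rightarrow> bool" where
  "subcoalgebra D \<longleftrightarrow> subspace D \<and>
     (\<forall>d\<in>D. \<exists>ts. set ts \<subseteq> D \<times> D \<and> tensor_eq scale UNIV (pair_words (\<Delta> d)) (pair_words ts))"

definition simple_subcoalgebra :: "'h set \<Rightarrow> bool" where
  "simple_subcoalgebra D \<longleftrightarrow> subcoalgebra D \<and> D \<noteq> {0} \<and>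
     (\<forall>E. subcoalgebra E \<and> E \<subseteq> D \<longrightarrow> E = {0} \<or> E = D)"

definition cosemisimple :: bool where
  "cosemisimple \<longleftrightarrow> span (\<Union>{D. simple_subcoalgebra D}) = UNIV"

definition left_integral :: "'h \<Rightarrow> bool" where
  "left_integral t \<longleftrightarrow> (\<forall>h. h * t = \<epsilon> h *s t)"

definition right_integral :: "'h \<Rightarrow> bool" where
  "right_integral t \<longleftrightarrow> (\<forall>h. t * h = \<epsilon> h *s t)"

definition unimodular :: bool where
  "unimodular \<longleftrightarrow> {t. left_integral t} = {t. right_integral t}"


subsection \<open>The dual\<close>

definition dual :: "('h \<Rightarrow> 'k) set" where
  "dual = {f. Vector_Spaces.linear scale (*) f}"

text \<open>A representative of the coproduct of \<open>f\<close> in \<open>H\<^sup>*\<close>. It exists and is unique as an element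
  of \<open>H\<^sup>* \<otimes> H\<^sup>*\<close> when \<open>H\<close> is finite dimensional.\<close>

definition dual_comult :: "('h \<Rightarrow> 'k) \<Rightarrow> (('h \<Rightarrow> 'k) \<times> ('h \<Rightarrow> 'k)) list" where
  "dual_comult f = (SOME ts. set ts \<subseteq> dual \<times> dual \<and>
                      (\<forall>x y. f (x * y) = (\<Sum>(f1, f2)\<leftarrow>ts. f1 x * f2 y)))"

definition dual_antipode :: "('h \<Rightarrow> 'k) \<Rightarrow> ('h \<Rightarrow> 'k)" where
  "dual_antipode f = (\<lambda>x. f (S x))"

text \<open>The counit of \<open>H\<^sup>*\<close> is evaluation at \<open>1\<close>. An integral of \<open>H\<^sup>*\<close> is a left or a right
  integral; the two notions coincide when \<open>H\<close> is finite dimensional and cosemisimple.\<close>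

definition dual_left_integral :: "('h \<Rightarrow> 'k) \<Rightarrow> bool" where
  "dual_left_integral l \<longleftrightarrow>
     l \<in> dual \<and> (\<forall>f\<in>dual. convolution \<Delta> f l = dual_scale (f 1) l)"

definition dual_right_integral :: "('h \<Rightarrow> 'k) \<Rightarrow> bool" where
  "dual_right_integral l \<longleftrightarrow>
     l \<in> dual \<and> (\<forall>f\<in>dual. convolution \<Delta> l f = dual_scale (f 1) l)"

definition dual_integral :: "('h \<Rightarrow> 'k) \<Rightarrow> bool" where
  "dual_integral l \<longleftrightarrow> dual_left_integral l \<or> dual_right_integral l"


subsection \<open>Actions\<close>

definition adj :: "'h \<Rightarrow> 'h \<Rightarrow> 'h" where
  "adj h a = (\<Sum>(h1, h2)\<leftarrow>\<Delta> h. h1 * a * S h2)"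

definition hit_left :: "'h \<Rightarrow> ('h \<Rightarrow> 'k) \<Rightarrow> ('h \<Rightarrow> 'k)" (infixr \<open>\<rightharpoonup>\<close> 72) where
  "(h \<rightharpoonup> f) = (\<lambda>x. f (x * h))"

definition hit_right :: "('h \<Rightarrow> 'k) \<Rightarrow> 'h \<Rightarrow> ('h \<Rightarrow> 'k)" (infixl \<open>\<leftharpoonup>\<close> 73) where
  "(f \<leftharpoonup> h) = (\<lambda>x. f (h * x))"

definition coadj :: "('h \<Rightarrow> 'k) \<Rightarrow> 'h \<Rightarrow> ('h \<Rightarrow> 'k)" (infixl \<open>\<triangleleft>\<close> 73) where
  "(f \<triangleleft> h) = (\<Sum>(h1, h2)\<leftarrow>\<Delta> h. S h2 \<rightharpoonup> (f \<leftharpoonup> h1))"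

end


section \<open>Quasi-triangular Hopf algebras and transmutation\<close>

locale quasitriangular_hopf_algebra = hopf_algebra scale \<Delta> \<epsilon> S
  for scale :: "'k::field \<Rightarrow> 'h::ring_1 \<Rightarrow> 'h" (infixr \<open>*s\<close> 75)
    and \<Delta> :: "'h \<Rightarrow> ('h \<times> 'h) list" and \<epsilon> :: "'h \<Rightarrow> 'k" and S :: "'h \<Rightarrow> 'h" +
  fixes R :: "('h \<times> 'h) list"
  assumes R_invertible:
      "\<exists>R'. tensor_eq scale UNIV (pair_words (tensor_mult (*) R R')) [[1, 1]] \<and>
            tensor_eq scale UNIV (pair_words (tensor_mult (*) R' R)) [[1, 1]]"
    and R_intertwines:
      "tensor_eq scale UNIV [[r1 * h1, r2 * h2]. (r1, r2) \<leftarrow> R, (h1, h2) \<leftarrow> \<Delta> h]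
                            [[h2 * r1, h1 * r2]. (r1, r2) \<leftarrow> R, (h1, h2) \<leftarrow> \<Delta> h]"
    and R_comult_left:  \<comment> \<open>\<open>(\<Delta> \<otimes> id) R = R\<^sup>1\<^sup>3 R\<^sup>2\<^sup>3\<close>\<close>
      "tensor_eq scale UNIV [[a, b, r2]. (r1, r2) \<leftarrow> R, (a, b) \<leftarrow> \<Delta> r1]
                            [[r1, q1, r2 * q2]. (r1, r2) \<leftarrow> R, (q1, q2) \<leftarrow> R]"
    and R_comult_right:  \<comment> \<open>\<open>(id \<otimes> \<Delta>) R = R\<^sup>1\<^sup>3 R\<^sup>1\<^sup>2\<close>\<close>
      "tensor_eq scale UNIV [[r1, a, b]. (r1, r2) \<leftarrow> R, (a, b) \<leftarrow> \<Delta> r2]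
                            [[r1 * q1, q2, r2]. (r1, r2) \<leftarrow> R, (q1, q2) \<leftarrow> R]"
begin

definition comult_R :: "'h \<Rightarrow> ('h \<times> 'h) list" where
  "comult_R h = [(h1 * S r2, adj r1 h2). (r1, r2) \<leftarrow> R, (h1, h2) \<leftarrow> \<Delta> h]"

definition mult_R :: "('h \<Rightarrow> 'k) \<Rightarrow> ('h \<Rightarrow> 'k) \<Rightarrow> ('h \<Rightarrow> 'k)" where
  "mult_R = convolution comult_R"

definition e_R :: "('h \<Rightarrow> 'k) \<Rightarrow> (('h \<Rightarrow> 'k) \<times> ('h \<Rightarrow> 'k)) list" where
  "e_R l = [(r2 \<rightharpoonup> l1, dual_antipode l2 \<triangleleft> r1). (r1, r2) \<leftarrow> R, (l1, l2) \<leftarrow> dual_comult l]"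

end

end

theory Submission
  imports Defs
begin

text \<open>
  Write \<open>R\<^sup>1 \<otimes> R\<^sup>2\<close>, \<open>Q\<^sup>1 \<otimes> Q\<^sup>2\<close> for copies of \<open>R\<close> with the summation sign dropped, \<open>h \<cdot> x\<close> for the adjoint
  action and \<open>\<Delta>\<^sub>R(x) = x\<^sup>1 \<otimes> x\<^sup>2\<close>. As a bilinear form on \<open>H\<close>, the element \<open>e\<^sub>R\<close> is
  \<open>E(x, y) = \<lambda>(x R\<^sup>2 S(R\<^sup>1 \<cdot> y))\<close>, because \<open>\<lambda>\<^sub>1(x) \<lambda>\<^sub>2(S y) = \<lambda>(x S(y))\<close>. In finite dimension an
  element of \<open>H\<^sup>* \<otimes> H\<^sup>*\<close> is determined by its bilinear form, so the two identities say
  \<open>E(x\<^sup>1, x\<^sup>2) = \<epsilon>(x)\<close> and \<open>f(x\<^sup>1) E(x\<^sup>2, y) = E(x, y\<^sup>1) f(y\<^sup>2)\<close>.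

  The first identity holds because \<open>R\<^sup>1 Q\<^sup>1 \<otimes> S(Q\<^sup>2) R\<^sup>2 = 1 \<otimes> 1\<close> (\<open>R_antipode_left\<close>) cancels both
  copies of \<open>R\<close> and leaves \<open>\<lambda>(x\<^sub>1 S(x\<^sub>2)) = \<epsilon>(x)\<close>.

  The second identity rests on the invariance of \<open>E\<close> under the adjoint action
  (\<open>e_form_invariant\<close>). It needs the Nakayama automorphism of \<open>\<lambda>\<close>, namely
  \<open>\<lambda>(z S\<^sup>2(a)) = \<lambda>(a z)\<close>, and this is where unimodularity enters: \<open>biinvariant_nakayama\<close> uses a
  two-sided integral \<open>\<Lambda>\<close> of \<open>H\<close> with \<open>\<lambda>(\<Lambda>) = 1\<close>. A left integral of this kind is given by a trace
  formula (\<open>normalized_left_integral\<close>), and unimodularity makes it two-sided. Invariance allows the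
  copy of \<open>R\<close> in \<open>\<Delta>\<^sub>R(x)\<close> to be moved from \<open>x\<close> to \<open>y\<close> (\<open>e_form_transfer\<close>), where it combines with the
  copy in \<open>E\<close> to the coproduct of \<open>R\<^sup>2\<close>. What is left is \<open>f(z\<^sub>1) \<lambda>(z\<^sub>2 S(c))\<close> with \<open>z = x R\<^sup>2\<close> and
  \<open>c = R\<^sup>1 \<cdot> y\<close>, and \<open>biinvariant_antipode_shift\<close> turns it into \<open>\<lambda>(z S(c\<^sub>1)) f(c\<^sub>2)\<close>. Expressing
  \<open>\<Delta>(c)\<close> through \<open>\<Delta>\<^sub>R(c)\<close> and using that \<open>\<Delta>\<^sub>R\<close> commutes with the adjoint action
  (\<open>comult_from_comult_R\<close>, \<open>comult_R_adj\<close>) gives \<open>E(x, y\<^sup>1) f(y\<^sup>2)\<close> (\<open>e_form_central\<close>).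

  The same equivariance makes \<open>\<Delta>\<^sub>R\<close> coassociative, so \<open>H\<^sub>R\<^sup>*\<close> is an algebra. Averaging linear
  projections with the separable idempotent complements every left ideal, hence \<open>H\<^sub>R\<^sup>*\<close> is
  semisimple (\<open>semisimple_algebra_of_separable\<close>).

  Sweedler sums are sums over lists, and an identity in a tensor power is used and proved by
  evaluating all multilinear forms on both sides.
\<close>

section \<open>Sums over lists of pairs\<close>

lemma pair_sum_cong:
  "(\<And>a b. F a b = G a b) \<Longrightarrow> (\<Sum>(a, b)\<leftarrow>ts. F a b) = (\<Sum>(a, b)\<leftarrow>ts. G a b)"
  by presburger

lemma pair_sum_cong_set:
  "(\<And>a b. (a, b) \<in> set ts \<Longrightarrow> F a b = G a b) \<Longrightarrow> (\<Sum>(a, b)\<leftarrow>ts. F a b) = (\<Sum>(a, b)\<leftarrow>ts. G a b)"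
  by (intro arg_cong[where f = sum_list] map_cong) auto

lemma pair_sum_add:
  "(\<Sum>(a, b)\<leftarrow>ts. F a b + G a b) = (\<Sum>(a, b)\<leftarrow>ts. F a b) + (\<Sum>(a, b)\<leftarrow>ts. G a b :: 'c::comm_monoid_add)"
  by (induction ts) (auto simp: algebra_simps)

lemma pair_sum_mult_left:
  "(\<Sum>(a, b)\<leftarrow>ts. c * F a b) = c * (\<Sum>(a, b)\<leftarrow>ts. F a b :: 'c::semiring_0)"
  by (induction ts) (auto simp: algebra_simps)

lemma pair_sum_mult_right:
  "(\<Sum>(a, b)\<leftarrow>ts. F a b * c) = (\<Sum>(a, b)\<leftarrow>ts. F a b :: 'c::semiring_0) * c"
  by (induction ts) (auto simp: algebra_simps)

lemma pair_sum_zero: "(\<Sum>(a, b)\<leftarrow>ts. 0 :: 'c::comm_monoid_add) = 0"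
  by (induction ts) auto

lemma pair_sum_swap:
  "(\<Sum>(a, b)\<leftarrow>ts. \<Sum>(c, d)\<leftarrow>us. F a b c d)
     = (\<Sum>(c, d)\<leftarrow>us. \<Sum>(a, b)\<leftarrow>ts. F a b c d :: 'c::comm_monoid_add)"
  by (induction ts) (auto simp: pair_sum_add pair_sum_zero)

lemma pair_sum_sum_swap:
  "(\<Sum>(a, b)\<leftarrow>ts. \<Sum>i\<in>I. F a b i) = (\<Sum>i\<in>I. \<Sum>(a, b)\<leftarrow>ts. F a b i :: 'c::comm_monoid_add)"
  by (induction ts) (auto simp: sum.distrib)

lemma pair_sum_fun: "(\<Sum>(a, b)\<leftarrow>ts. F a b) x = (\<Sum>(a, b)\<leftarrow>ts. F a b x)"
  by (induction ts) (auto simp: plus_fun_def zero_fun_def)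

lemma sum_list_concat_pairs:
  "(\<Sum>x\<leftarrow>concat (map f ts). g x) = (\<Sum>t\<leftarrow>ts. \<Sum>x\<leftarrow>f t. g x :: 'c::comm_monoid_add)"
  by (induction ts) auto


section \<open>Evaluating and comparing tensors\<close>

lemma lookup_map_times:
  "Poly_Mapping.lookup (Poly_Mapping.map ((*) c) p) w = c * Poly_Mapping.lookup p (w :: 'w) " for c :: "'k::field"
  by (simp add: Poly_Mapping.map.rep_eq when_def)

lemma vector_space_formal_sums:
  "vector_space (\<lambda>c::'k::field. Poly_Mapping.map ((*) c) :: ('w \<Rightarrow>\<^sub>0 'k) \<Rightarrow> _)"
  by unfold_locales
    (auto intro!: poly_mapping_eqI simp: lookup_map_times lookup_add algebra_simps)

lemma map_times_single:
  "Poly_Mapping.map ((*) c) (Poly_Mapping.single w d) = Poly_Mapping.single w (c * d :: 'k::field)"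
  by (auto intro!: poly_mapping_eqI simp: lookup_map_times lookup_single when_def)

text \<open>A multilinear map on words extends linearly to formal sums of words and kills the
  multilinearity relations. The letters are restricted to \<open>V\<close> because the product of an algebra may
  be bilinear on a subspace of the ambient type only.\<close>

lemma tensor_eq_eval:
  fixes s :: "'k::field \<Rightarrow> 'a::ab_group_add \<Rightarrow> 'a"
    and s' :: "'k \<Rightarrow> 'b::ab_group_add \<Rightarrow> 'b"
  assumes "vector_space s'" and eq: "tensor_eq s V ts us"
    and add: "\<And>us x y vs. set us \<subseteq> V \<Longrightarrow> x \<in> V \<Longrightarrow> y \<in> V \<Longrightarrow> set vs \<subseteq> V \<Longrightarrow>
                \<phi> (us @ [x + y] @ vs) = \<phi> (us @ [x] @ vs) + \<phi> (us @ [y] @ vs)"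
    and scale: "\<And>us c x vs. set us \<subseteq> V \<Longrightarrow> x \<in> V \<Longrightarrow> set vs \<subseteq> V \<Longrightarrow>
                \<phi> (us @ [s c x] @ vs) = s' c (\<phi> (us @ [x] @ vs))"
  shows "(\<Sum>w\<leftarrow>ts. \<phi> w) = (\<Sum>w\<leftarrow>us. \<phi> w)"
proof -
  interpret T: vector_space s' by fact
  interpret P: vector_space "\<lambda>c::'k. Poly_Mapping.map ((*) c) :: ('a list \<Rightarrow>\<^sub>0 'k) \<Rightarrow> _"
    by (rule vector_space_formal_sums)
  define \<Phi> where "\<Phi> p = (\<Sum>w\<in>Poly_Mapping.keys p. s' (Poly_Mapping.lookup p w) (\<phi> w))" for p
  have \<Phi>_superset: "\<Phi> p = (\<Sum>w\<in>K. s' (Poly_Mapping.lookup p w) (\<phi> w))"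
    if "finite K" "Poly_Mapping.keys p \<subseteq> K" for p K
    unfolding \<Phi>_def using that by (intro sum.mono_neutral_left) (auto simp: in_keys_iff)
  have \<Phi>_add: "\<Phi> (p + q) = \<Phi> p + \<Phi> q" for p q
  proof -
    let ?K = "Poly_Mapping.keys p \<union> Poly_Mapping.keys q \<union> Poly_Mapping.keys (p + q)"
    have "\<Phi> (p + q) = (\<Sum>w\<in>?K. s' (Poly_Mapping.lookup (p + q) w) (\<phi> w))"
      "\<Phi> p = (\<Sum>w\<in>?K. s' (Poly_Mapping.lookup p w) (\<phi> w))"
      "\<Phi> q = (\<Sum>w\<in>?K. s' (Poly_Mapping.lookup q w) (\<phi> w))"
      by (intro \<Phi>_superset; auto)+
    then show ?thesis
      by (simp add: lookup_add T.scale_left_distrib sum.distrib)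
  qed
  have \<Phi>_scale: "\<Phi> (Poly_Mapping.map ((*) c) p) = s' c (\<Phi> p)" for c p
  proof -
    have "Poly_Mapping.keys (Poly_Mapping.map ((*) c) p) \<subseteq> Poly_Mapping.keys p"
      by (auto simp: in_keys_iff lookup_map_times)
    then have "\<Phi> (Poly_Mapping.map ((*) c) p)
        = (\<Sum>w\<in>Poly_Mapping.keys p. s' (Poly_Mapping.lookup (Poly_Mapping.map ((*) c) p) w) (\<phi> w))"
      by (intro \<Phi>_superset) auto
    then show ?thesis
      by (simp add: lookup_map_times \<Phi>_def T.scale_sum_right)
  qed
  have \<Phi>_single: "\<Phi> (Poly_Mapping.single w c) = s' c (\<phi> w)" for w c
    using \<Phi>_superset[of "{w}" "Poly_Mapping.single w c"] by simp
  have \<Phi>_diff: "\<Phi> (p - q) = \<Phi> p - \<Phi> q" for p q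
    using \<Phi>_add[of "p - q" q] by simp
  have \<Phi>_0: "\<Phi> 0 = 0" by (simp add: \<Phi>_def)
  have "\<Phi> r = 0" if "r \<in> P.span (multilinear_relations s V)" for r
    using that
  proof (induction rule: P.span_induct)
    case base
    show ?case by (auto simp: P.subspace_def \<Phi>_add \<Phi>_scale \<Phi>_0)
  next
    case (step r)
    then show ?case
      unfolding multilinear_relations_def
      by (auto simp: \<Phi>_diff \<Phi>_single add scale simp del: append_Cons append_Nil)
  qed
  then have "\<Phi> (formal_sum ts) = \<Phi> (formal_sum us)"
    using eq \<Phi>_diff unfolding tensor_eq_def by (metis right_minus_eq)
  moreover have "\<Phi> (formal_sum ts) = (\<Sum>w\<leftarrow>ts. \<phi> w)" for ts
    by (induction ts) (auto simp: formal_sum_def \<Phi>_0 \<Phi>_add \<Phi>_single)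
  ultimately show ?thesis by simp
qed

lemma tensor_eq_eval_pairs:
  fixes s :: "'k::field \<Rightarrow> 'a::ab_group_add \<Rightarrow> 'a"
    and s' :: "'k \<Rightarrow> 'b::ab_group_add \<Rightarrow> 'b"
  assumes "vector_space s'" "tensor_eq s V (pair_words ts) (pair_words us)"
    and "\<And>x y b. x \<in> V \<Longrightarrow> y \<in> V \<Longrightarrow> b \<in> V \<Longrightarrow> F (x + y) b = F x b + F y b"
    and "\<And>a x y. a \<in> V \<Longrightarrow> x \<in> V \<Longrightarrow> y \<in> V \<Longrightarrow> F a (x + y) = F a x + F a y"
    and "\<And>c x b. x \<in> V \<Longrightarrow> b \<in> V \<Longrightarrow> F (s c x) b = s' c (F x b)"
    and "\<And>c a x. a \<in> V \<Longrightarrow> x \<in> V \<Longrightarrow> F a (s c x) = s' c (F a x)"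
  shows "(\<Sum>(a, b)\<leftarrow>ts. F a b) = (\<Sum>(a, b)\<leftarrow>us. F a b)"
proof -
  interpret T: vector_space s' by fact
  \<comment> \<open>Words of other lengths do not occur; they are sent to \<open>0\<close>.\<close>
  define \<phi> where "\<phi> w = (if length w = 2 then F (w ! 0) (w ! 1) else 0)" for w
  have "(\<Sum>w\<leftarrow>pair_words ts. \<phi> w) = (\<Sum>w\<leftarrow>pair_words us. \<phi> w)"
  proof (rule tensor_eq_eval[OF assms(1,2)])
    show "\<phi> (us @ [x + y] @ vs) = \<phi> (us @ [x] @ vs) + \<phi> (us @ [y] @ vs)"
      if "set us \<subseteq> V" "x \<in> V" "y \<in> V" "set vs \<subseteq> V" for us x y vs
      using that assms(3,4)
      by (cases us; cases vs) (auto simp: \<phi>_def nth_append nth_Cons')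
    show "\<phi> (us @ [s c x] @ vs) = s' c (\<phi> (us @ [x] @ vs))"
      if "set us \<subseteq> V" "x \<in> V" "set vs \<subseteq> V" for us c x vs
      using that assms(5,6)
      by (cases us; cases vs) (auto simp: \<phi>_def nth_append nth_Cons')
  qed
  moreover have "(\<Sum>w\<leftarrow>pair_words ts. \<phi> w) = (\<Sum>(a, b)\<leftarrow>ts. F a b)" for ts
    by (induction ts) (auto simp: pair_words_def \<phi>_def)
  ultimately show ?thesis by simp
qed

text \<open>The map \<open>\<phi>\<close> extends \<open>F\<close> by \<open>0\<close> to words of other lengths. It is a parameter so that the sums in
  the conclusion simplify directly to Sweedler sums.\<close>

lemma tensor_eq_eval_triples:
  fixes s :: "'k::field \<Rightarrow> 'a::ab_group_add \<Rightarrow> 'a"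
    and F :: "'a \<Rightarrow> 'a \<Rightarrow> 'a \<Rightarrow> 'k"
  assumes "tensor_eq s UNIV ts us"
    and "\<And>x y b c. F (x + y) b c = F x b c + F y b c"
    and "\<And>a x y c. F a (x + y) c = F a x c + F a y c"
    and "\<And>a b x y. F a b (x + y) = F a b x + F a b y"
    and "\<And>k x b c. F (s k x) b c = k * F x b c"
    and "\<And>k a x c. F a (s k x) c = k * F a x c"
    and "\<And>k a b x. F a b (s k x) = k * F a b x"
    and \<phi>: "\<And>w. \<phi> w = (if length w = 3 then F (w ! 0) (w ! 1) (w ! 2) else 0)"
  shows "(\<Sum>w\<leftarrow>ts. \<phi> w) = (\<Sum>w\<leftarrow>us. \<phi> w)"
proof (rule tensor_eq_eval[OF _ assms(1)])
  show "vector_space ((*) :: 'k \<Rightarrow> 'k \<Rightarrow> 'k)"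
    by unfold_locales (auto simp: algebra_simps)
  have split: "us = [] \<and> (\<exists>b c. vs = [b, c]) \<or> (\<exists>a c. us = [a] \<and> vs = [c])
      \<or> (\<exists>a b. us = [a, b]) \<and> vs = []"
    if "length us + length vs = 2" for us vs :: "'a list"
    using that by (cases us; cases vs; cases "tl us"; cases "tl vs") auto
  show "\<phi> (us @ [x + y] @ vs) = \<phi> (us @ [x] @ vs) + \<phi> (us @ [y] @ vs)" for us x y vs
  proof (cases "length us + length vs = 2")
    case True
    from split[OF this] show ?thesis by (elim disjE exE conjE) (auto simp: \<phi> assms(2-4))
  qed (simp add: \<phi>)
  show "\<phi> (us @ [s c x] @ vs) = c * \<phi> (us @ [x] @ vs)" for us c x vs
  proof (cases "length us + length vs = 2")
    case True
    from split[OF this] show ?thesis by (elim disjE exE conjE) (auto simp: \<phi> assms(5-7))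
  qed (simp add: \<phi>)
qed

text \<open>Modulo the multilinearity relations, \<open>x \<mapsto> x \<otimes> b\<close> and \<open>x \<mapsto> a \<otimes> x\<close> are linear. So every
  tensor in \<open>V \<otimes> V\<close> has a normal form \<open>\<Sum>\<^sub>i e\<^sub>i \<otimes> y\<^sub>i\<close> with respect to a finite coordinate system
  \<open>x = \<Sum>\<^sub>i c\<^sub>i(x) e\<^sub>i\<close> of \<open>V\<close>, and the \<open>y\<^sub>i\<close> decide equality.\<close>

lemma tensor_eq_coordinates:
  fixes s :: "'k::field \<Rightarrow> 'a::ab_group_add \<Rightarrow> 'a"
  assumes "vector_space s" and V: "module.subspace s V"
    and "finite I" and e: "e ` I \<subseteq> V"
    and coord: "\<And>x. x \<in> V \<Longrightarrow> x = (\<Sum>i\<in>I. s (c i x) (e i))"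
    and ts: "set ts \<subseteq> V \<times> V" and us: "set us \<subseteq> V \<times> V"
    and eq: "\<And>i. i \<in> I \<Longrightarrow> (\<Sum>(a, b)\<leftarrow>ts. s (c i a) b) = (\<Sum>(a, b)\<leftarrow>us. s (c i a) b)"
  shows "tensor_eq s V (pair_words ts) (pair_words us)"
proof -
  interpret S: vector_space s by fact
  interpret P: vector_space "\<lambda>c::'k. Poly_Mapping.map ((*) c) :: ('a list \<Rightarrow>\<^sub>0 'k) \<Rightarrow> _"
    by (rule vector_space_formal_sums)
  let ?N = "P.span (multilinear_relations s V)"
  let ?t = "\<lambda>a b. Poly_Mapping.single [a, b] (1::'k)"
  have rel_add: "Poly_Mapping.single (us @ [x + y] @ vs) 1 - Poly_Mapping.single (us @ [x] @ vs) 1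
      - Poly_Mapping.single (us @ [y] @ vs) (1::'k) \<in> ?N"
    if "set us \<subseteq> V" "x \<in> V" "y \<in> V" "set vs \<subseteq> V" for us x y vs
    using that unfolding multilinear_relations_def by (intro P.span_base) blast
  have rel_scale: "Poly_Mapping.single (us @ [s k x] @ vs) 1 - Poly_Mapping.single (us @ [x] @ vs) k
      \<in> ?N"
    if "set us \<subseteq> V" "x \<in> V" "set vs \<subseteq> V" for us k x vs
    using that unfolding multilinear_relations_def by (intro P.span_base) blast
  have add_left: "?t (x + y) b - (?t x b + ?t y b) \<in> ?N" if "x \<in> V" "y \<in> V" "b \<in> V" for x y b
    using rel_add[of "[]" x y "[b]"] that by (simp add: diff_diff_eq)
  have add_right: "?t a (x + y) - (?t a x + ?t a y) \<in> ?N" if "a \<in> V" "x \<in> V" "y \<in> V" for a x y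
    using rel_add[of "[a]" x y "[]"] that by (simp add: diff_diff_eq)
  have scale_left: "?t (s k x) b - Poly_Mapping.map ((*) k) (?t x b) \<in> ?N"
    if "x \<in> V" "b \<in> V" for k x b
    using rel_scale[of "[]" x "[b]" k] that by (simp add: map_times_single)
  have scale_right: "?t a (s k x) - Poly_Mapping.map ((*) k) (?t a x) \<in> ?N"
    if "a \<in> V" "x \<in> V" for k x a
    using rel_scale[of "[a]" x "[]" k] that by (simp add: map_times_single)
  have zero_left: "?t 0 b \<in> ?N" if "b \<in> V" for b
    using scale_left[of 0 b 0] that S.subspace_0[OF V] by (simp add: map_times_single)
  have zero_right: "?t a 0 \<in> ?N" if "a \<in> V" for a
    using scale_right[of a 0 0] that S.subspace_0[OF V] by (simp add: map_times_single)
  have expand: "?t a b - (\<Sum>i\<in>I. ?t (e i) (s (c i a) b)) \<in> ?N" if "a \<in> V" "b \<in> V" for a b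
  proof -
    have "?t (\<Sum>i\<in>J. s (k i) (e i)) b - (\<Sum>i\<in>J. ?t (e i) (s (k i) b)) \<in> ?N"
      if "J \<subseteq> I" for J k
      using finite_subset[OF that \<open>finite I\<close>] that
    proof (induction J)
      case empty
      then show ?case using zero_left[OF \<open>b \<in> V\<close>] by simp
    next
      case (insert j J)
      let ?x = "\<Sum>i\<in>J. s (k i) (e i)"
      have x: "?x \<in> V" and j: "e j \<in> V"
        using insert.prems e by (auto intro!: S.subspace_sum[OF V] S.subspace_scale[OF V])
      have "?t (s (k j) (e j) + ?x) b - (?t (s (k j) (e j)) b + ?t ?x b) \<in> ?N"
        using x j \<open>b \<in> V\<close> by (intro add_left S.subspace_scale[OF V])
      moreover have "?t (s (k j) (e j)) b - Poly_Mapping.map ((*) (k j)) (?t (e j) b) \<in> ?N"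
        using j \<open>b \<in> V\<close> by (intro scale_left)
      moreover have "?t (e j) (s (k j) b) - Poly_Mapping.map ((*) (k j)) (?t (e j) b) \<in> ?N"
        using j \<open>b \<in> V\<close> by (intro scale_right)
      moreover have "?t ?x b - (\<Sum>i\<in>J. ?t (e i) (s (k i) b)) \<in> ?N"
        using insert by auto
      ultimately have "(?t (s (k j) (e j) + ?x) b - (?t (s (k j) (e j)) b + ?t ?x b))
          + (?t (s (k j) (e j)) b - Poly_Mapping.map ((*) (k j)) (?t (e j) b))
          - (?t (e j) (s (k j) b) - Poly_Mapping.map ((*) (k j)) (?t (e j) b))
          + (?t ?x b - (\<Sum>i\<in>J. ?t (e i) (s (k i) b))) \<in> ?N"
        by (rule P.span_add[OF P.span_diff[OF P.span_add]])
      then show ?case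
        using insert.hyps by (simp add: algebra_simps)
    qed
    from this[of I "\<lambda>i. c i a"] show ?thesis
      using coord[OF \<open>a \<in> V\<close>] by simp
  qed
  have collect: "(\<Sum>(a, b)\<leftarrow>vs. ?t x (s (k a) b)) - ?t x (\<Sum>(a, b)\<leftarrow>vs. s (k a) b) \<in> ?N
      \<and> (\<Sum>(a, b)\<leftarrow>vs. s (k a) b) \<in> V"
    if "x \<in> V" "set vs \<subseteq> V \<times> V" for x k vs
    using that(2)
  proof (induction vs)
    case Nil
    then show ?case using P.span_neg[OF zero_right[OF that(1)]] S.subspace_0[OF V] by simp
  next
    case (Cons v vs)
    obtain a b where v: "v = (a, b)" by (cases v)
    let ?y = "\<Sum>(a, b)\<leftarrow>vs. s (k a) b"
    from Cons have IH: "(\<Sum>(a, b)\<leftarrow>vs. ?t x (s (k a) b)) - ?t x ?y \<in> ?N" "?y \<in> V" and "b \<in> V"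
      using v by auto
    have "?t x (s (k a) b + ?y) - (?t x (s (k a) b) + ?t x ?y) \<in> ?N"
      using IH that(1) \<open>b \<in> V\<close> by (intro add_right S.subspace_scale[OF V])
    from P.span_diff[OF IH(1) this]
    have "(\<Sum>(a, b)\<leftarrow>vs. ?t x (s (k a) b)) - ?t x ?y
        - (?t x (s (k a) b + ?y) - (?t x (s (k a) b) + ?t x ?y)) \<in> ?N" .
    then show ?case
      using IH \<open>b \<in> V\<close> by (auto simp: v algebra_simps intro!: S.subspace_add[OF V] S.subspace_scale[OF V])
  qed
  have normal_form: "formal_sum (pair_words vs) - (\<Sum>i\<in>I. ?t (e i) (\<Sum>(a, b)\<leftarrow>vs. s (c i a) b)) \<in> ?N"
    if vs: "set vs \<subseteq> V \<times> V" for vs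
  proof -
    have "formal_sum (pair_words vs) - (\<Sum>(a, b)\<leftarrow>vs. \<Sum>i\<in>I. ?t (e i) (s (c i a) b)) \<in> ?N"
      using vs
    proof (induction vs)
      case (Cons v vs)
      obtain a b where v: "v = (a, b)" by (cases v)
      have "(?t a b - (\<Sum>i\<in>I. ?t (e i) (s (c i a) b)))
          + (formal_sum (pair_words vs) - (\<Sum>(a, b)\<leftarrow>vs. \<Sum>i\<in>I. ?t (e i) (s (c i a) b))) \<in> ?N"
        using Cons v by (intro P.span_add[OF expand]) auto
      then show ?case
        by (simp add: v pair_words_def formal_sum_def algebra_simps)
    qed (simp add: pair_words_def formal_sum_def P.span_zero)
    moreover have "(\<Sum>i\<in>I. (\<Sum>(a, b)\<leftarrow>vs. ?t (e i) (s (c i a) b))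
        - ?t (e i) (\<Sum>(a, b)\<leftarrow>vs. s (c i a) b)) \<in> ?N"
      using e vs by (intro P.span_sum conjunct1[OF collect]) auto
    ultimately have "formal_sum (pair_words vs) - (\<Sum>(a, b)\<leftarrow>vs. \<Sum>i\<in>I. ?t (e i) (s (c i a) b))
        + (\<Sum>i\<in>I. (\<Sum>(a, b)\<leftarrow>vs. ?t (e i) (s (c i a) b))
             - ?t (e i) (\<Sum>(a, b)\<leftarrow>vs. s (c i a) b)) \<in> ?N"
      by (rule P.span_add)
    then show ?thesis
      by (simp add: pair_sum_sum_swap sum_subtractf)
  qed
  have "(\<Sum>i\<in>I. ?t (e i) (\<Sum>(a, b)\<leftarrow>ts. s (c i a) b)) = (\<Sum>i\<in>I. ?t (e i) (\<Sum>(a, b)\<leftarrow>us. s (c i a) b))"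
    using eq by (intro sum.cong) auto
  then show ?thesis
    using P.span_diff[OF normal_form[OF ts] normal_form[OF us]]
    by (simp add: tensor_eq_def)
qed

section \<open>Separability implies semisimplicity\<close>

lemma (in vector_space) dim_psubset_subspace:
  assumes "finite G" and J: "subspace J" "J \<subseteq> span G" and I: "subspace I" and "I \<subset> J"
  shows "dim I < dim J"
proof -
  obtain x where x: "x \<in> J" "x \<notin> I" using \<open>I \<subset> J\<close> by auto
  obtain C where C: "C \<subseteq> I" "independent C" "I \<subseteq> span C" "card C = dim I" by (rule basis_exists)
  obtain D where D: "D \<subseteq> J" "independent D" "J \<subseteq> span D" "card D = dim J" by (rule basis_exists)
  have "finite D"
    using independent_span_bound[OF \<open>finite G\<close> D(2)] D(1) J(2) by auto
  have "span C = I"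
    using span_subspace[OF C(1,3) I] .
  then have "independent (insert x C)"
    using C(2) x(2) by (simp add: independent_insertI)
  moreover have "insert x C \<subseteq> span D"
    using C(1) D(3) x(1) \<open>I \<subset> J\<close> by auto
  ultimately have "finite (insert x C) \<and> card (insert x C) \<le> card D"
    by (rule independent_span_bound[OF \<open>finite D\<close>])
  moreover have "x \<notin> C" using C(1) x(2) by auto
  ultimately show ?thesis
    using C(4) D(4) by auto
qed

text \<open>For a left ideal \<open>I\<close> choose a linear projection \<open>p\<close> onto \<open>I\<close>. If \<open>\<Sum> a \<otimes> b\<close> is a separable
  idempotent, the average \<open>x \<mapsto> \<Sum> a p(b x)\<close> is still a projection onto \<open>I\<close>, and it commutes with
  left multiplication. Its kernel is a left ideal complementing \<open>I\<close>.\<close>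

lemma separable_left_ideal_complement:
  fixes s :: "'k::field \<Rightarrow> 'a::ab_group_add \<Rightarrow> 'a"
  assumes vs: "vector_space s" and A: "unital_algebra s A m u"
    and ts: "set ts \<subseteq> A \<times> A" and unit: "(\<Sum>(a, b)\<leftarrow>ts. m a b) = u"
    and central: "\<And>f. f \<in> A \<Longrightarrow>
        tensor_eq s A (pair_words (tensor_mult m [(f, u)] ts)) (pair_words (tensor_mult m ts [(u, f)]))"
    and I: "left_ideal s A m I"
  obtains J where "left_ideal s A m J" "I \<inter> J = {0}" "\<And>x. x \<in> A \<Longrightarrow> \<exists>i\<in>I. \<exists>j\<in>J. x = i + j"
proof -
  interpret S: vector_space s by fact
  interpret SS: vector_space_pair s s ..
  have sub: "S.subspace A" and uA: "u \<in> A"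
    and mA: "\<And>x y. x \<in> A \<Longrightarrow> y \<in> A \<Longrightarrow> m x y \<in> A"
    and add_l: "\<And>x y z. x \<in> A \<Longrightarrow> y \<in> A \<Longrightarrow> z \<in> A \<Longrightarrow> m (x + y) z = m x z + m y z"
    and add_r: "\<And>x y z. x \<in> A \<Longrightarrow> y \<in> A \<Longrightarrow> z \<in> A \<Longrightarrow> m x (y + z) = m x y + m x z"
    and sc_l: "\<And>c x y. x \<in> A \<Longrightarrow> y \<in> A \<Longrightarrow> m (s c x) y = s c (m x y)"
    and sc_r: "\<And>c x y. x \<in> A \<Longrightarrow> y \<in> A \<Longrightarrow> m x (s c y) = s c (m x y)"
    and assoc: "\<And>x y z. x \<in> A \<Longrightarrow> y \<in> A \<Longrightarrow> z \<in> A \<Longrightarrow> m (m x y) z = m x (m y z)"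
    and unit_l: "\<And>x. x \<in> A \<Longrightarrow> m u x = x" and unit_r: "\<And>x. x \<in> A \<Longrightarrow> m x u = x"
    using A by (auto simp: unital_algebra_def)
  have Isub: "S.subspace I" and IA: "I \<subseteq> A" and mI: "\<And>a x. a \<in> A \<Longrightarrow> x \<in> I \<Longrightarrow> m a x \<in> I"
    using I by (auto simp: left_ideal_def)
  obtain p where pI: "\<And>x. p x \<in> I" and plin: "Vector_Spaces.linear s s p"
    and pid: "\<And>x. x \<in> I \<Longrightarrow> p x = x"
    using SS.linear_exists_left_inverse_on[OF S.linear_id Isub] by auto
  interpret p: Vector_Spaces.linear s s p by fact
  have pA: "p x \<in> A" for x using pI IA by auto
  have zero_r: "m a 0 = 0" if "a \<in> A" for a
    using sc_r[OF that uA, of 0] by simp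
  have zero_l: "m 0 a = 0" if "a \<in> A" for a
    using sc_l[OF uA that, of 0] by simp
  have sum_mult: "m (\<Sum>(a, b)\<leftarrow>us. m a b) x = (\<Sum>(a, b)\<leftarrow>us. m a (m b x)) \<and> (\<Sum>(a, b)\<leftarrow>us. m a b) \<in> A"
    if "set us \<subseteq> A \<times> A" "x \<in> A" for us x
    using that
    by (induction us) (auto simp: zero_l S.subspace_0[OF sub] add_l mA assoc S.subspace_add[OF sub])
  have mult_sum: "m f (\<Sum>(a, b)\<leftarrow>us. m a (p (m b x))) = (\<Sum>(a, b)\<leftarrow>us. m (m f a) (p (m b x)))
      \<and> (\<Sum>(a, b)\<leftarrow>us. m a (p (m b x))) \<in> I"
    if "set us \<subseteq> A \<times> A" "f \<in> A" for us f x
    using that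
    by (induction us)
      (auto simp: zero_r S.subspace_0[OF Isub] add_r mA assoc pA mI pI subsetD[OF IA]
        intro!: S.subspace_add[OF Isub])
  define \<pi> where "\<pi> x = (\<Sum>(a, b)\<leftarrow>ts. m a (p (m b x)))" for x
  have \<pi>I: "\<pi> x \<in> I" for x
    using mult_sum[OF ts uA] by (simp add: \<pi>_def)
  have \<pi>id: "\<pi> x = x" if "x \<in> I" for x
  proof -
    have "\<pi> x = (\<Sum>(a, b)\<leftarrow>ts. m a (m b x))"
      unfolding \<pi>_def using ts that by (intro arg_cong[where f = sum_list] map_cong) (auto simp: pid mI)
    also have "\<dots> = x"
      using sum_mult[OF ts, of x] that IA by (auto simp: unit unit_l)
    finally show ?thesis .
  qed
  have \<pi>add: "\<pi> (x + y) = \<pi> x + \<pi> y" if "x \<in> A" "y \<in> A" for x y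
    unfolding \<pi>_def pair_sum_add[symmetric] using ts that
    by (intro arg_cong[where f = sum_list] map_cong) (auto simp: add_r mA p.add pA)
  have \<pi>scale: "\<pi> (s c x) = s c (\<pi> x)" if "x \<in> A" for c x
  proof -
    have "\<pi> (s c x) = (\<Sum>(a, b)\<leftarrow>ts. s c (m a (p (m b x))))"
      unfolding \<pi>_def using ts that
      by (intro arg_cong[where f = sum_list] map_cong) (auto simp: sc_r mA p.scale pA)
    also have "\<dots> = s c (\<pi> x)"
      unfolding \<pi>_def by (induction ts) (auto simp: S.scale_right_distrib)
    finally show ?thesis .
  qed
  have \<pi>mult: "\<pi> (m f x) = m f (\<pi> x)" if f: "f \<in> A" and x: "x \<in> A" for f x
  proof -
    have "m f (\<pi> x) = (\<Sum>(a, b)\<leftarrow>ts. m (m f a) (p (m b x)))"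
      using mult_sum[OF ts f] by (simp add: \<pi>_def)
    also have "\<dots> = (\<Sum>(a, b)\<leftarrow>tensor_mult m [(f, u)] ts. m a (p (m b x)))"
      using ts by (induction ts) (auto simp: tensor_mult_def unit_l)
    also have "\<dots> = (\<Sum>(a, b)\<leftarrow>tensor_mult m ts [(u, f)]. m a (p (m b x)))"
      using x by (intro tensor_eq_eval_pairs[OF vs central[OF f]])
        (auto simp: add_l add_r sc_l sc_r mA pA p.add p.scale)
    also have "\<dots> = (\<Sum>(a, b)\<leftarrow>ts. m a (p (m b (m f x))))"
      using ts f x by (induction ts) (auto simp: tensor_mult_def unit_r assoc)
    also have "\<dots> = \<pi> (m f x)" by (simp add: \<pi>_def)
    finally show ?thesis by simp
  qed
  define J where "J = {x \<in> A. \<pi> x = 0}"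
  have \<pi>0: "\<pi> 0 = 0" using \<pi>scale[OF uA, of 0] by simp
  show ?thesis
  proof
    show "left_ideal s A m J"
      unfolding left_ideal_def J_def S.subspace_def
      using sub by (auto simp: \<pi>0 \<pi>add \<pi>scale \<pi>mult mA zero_r S.subspace_def)
    show "I \<inter> J = {0}"
      using \<pi>id \<pi>0 S.subspace_0[OF Isub] S.subspace_0[OF sub] by (auto simp: J_def)
    show "\<exists>i\<in>I. \<exists>j\<in>J. x = i + j" if "x \<in> A" for x
    proof (intro bexI)
      have \<pi>A: "\<pi> x \<in> A" and diff: "x - \<pi> x \<in> A"
        using \<pi>I IA that by (auto intro: S.subspace_diff[OF sub])
      have "\<pi> x = \<pi> (\<pi> x) + \<pi> (x - \<pi> x)"
        using \<pi>add[OF \<pi>A diff] by simp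
      then show "x - \<pi> x \<in> J"
        using diff by (simp add: J_def \<pi>id[OF \<pi>I])
    qed (auto simp: \<pi>I)
  qed
qed

text \<open>A complement of the sum of all minimal left ideals would contain a minimal left ideal if it
  were nonzero, because dimensions cannot decrease forever.\<close>

theorem semisimple_algebra_of_separable:
  fixes s :: "'k::field \<Rightarrow> 'a::ab_group_add \<Rightarrow> 'a"
  assumes vs: "vector_space s" and A: "unital_algebra s A m u"
    and G: "finite G" "A \<subseteq> module.span s G"
    and ts: "set ts \<subseteq> A \<times> A" and unit: "(\<Sum>(a, b)\<leftarrow>ts. m a b) = u"
    and central: "\<And>f. f \<in> A \<Longrightarrow>
        tensor_eq s A (pair_words (tensor_mult m [(f, u)] ts)) (pair_words (tensor_mult m ts [(u, f)]))"
  shows "semisimple_algebra s A m u"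
proof -
  interpret S: vector_space s by fact
  have sub: "S.subspace A" using A by (simp add: unital_algebra_def)
  have minimal: "\<exists>M. minimal_left_ideal s A m M \<and> M \<subseteq> I"
    if "left_ideal s A m I" "I \<noteq> {0}" for I
    using that
  proof (induction "S.dim I" arbitrary: I rule: less_induct)
    case less
    show ?case
    proof (cases "\<exists>J. left_ideal s A m J \<and> J \<subset> I \<and> J \<noteq> {0}")
      case True
      then obtain J where J: "left_ideal s A m J" "J \<subset> I" "J \<noteq> {0}" by blast
      have "S.dim J < S.dim I"
        using less.prems(1) J(1,2) G by (intro S.dim_psubset_subspace[OF G(1)]) (auto simp: left_ideal_def)
      from less.hyps[OF this J(1,3)] J(2) show ?thesis by blast
    next
      case False
      then have "minimal_left_ideal s A m I"
        using less.prems by (auto simp: minimal_left_ideal_def)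
      then show ?thesis by blast
    qed
  qed
  define T where "T = S.span (\<Union>{I. minimal_left_ideal s A m I})"
  have UA: "\<Union>{I. minimal_left_ideal s A m I} \<subseteq> A"
    by (auto simp: minimal_left_ideal_def left_ideal_def)
  then have TA: "T \<subseteq> A"
    unfolding T_def by (rule S.span_minimal[OF _ sub])
  have "x \<in> A \<and> m a x \<in> T" if "a \<in> A" "x \<in> T" for a x
    using that(2) unfolding T_def
  proof (induction rule: S.span_induct_alt)
    case base
    have "m a 0 = 0"
      using A that(1) S.scale_zero_left unfolding unital_algebra_def by metis
    then show ?case by (simp add: S.span_zero S.subspace_0[OF sub])
  next
    case (step c x y)
    have x: "x \<in> A" using step UA by auto
    have "m a (s c x + y) = s c (m a x) + m a y"
      using A that(1) x step S.subspace_scale[OF sub x] by (auto simp: unital_algebra_def)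
    moreover have "m a x \<in> S.span (\<Union>{I. minimal_left_ideal s A m I})"
      using step(1) that(1) by (intro S.span_base) (auto simp: minimal_left_ideal_def left_ideal_def)
    ultimately show ?case
      using step x by (simp add: S.span_add S.span_scale S.subspace_add[OF sub] S.subspace_scale[OF sub])
  qed
  then have T: "left_ideal s A m T"
    using TA by (auto simp: left_ideal_def T_def)
  obtain J where J: "left_ideal s A m J" "T \<inter> J = {0}" "\<And>x. x \<in> A \<Longrightarrow> \<exists>i\<in>T. \<exists>j\<in>J. x = i + j"
    using separable_left_ideal_complement[OF vs A ts unit central T] by blast
  have "J = {0}"
  proof (rule ccontr)
    assume "J \<noteq> {0}"
    from minimal[OF J(1) this] obtain M where M: "minimal_left_ideal s A m M" "M \<subseteq> J" by blast
    then have "M \<subseteq> T" unfolding T_def by (intro subsetI S.span_base) auto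
    then have "M \<subseteq> {0}" using M(2) J(2) by auto
    moreover have "0 \<in> M" "M \<noteq> {0}"
      using M(1) S.subspace_0 by (auto simp: minimal_left_ideal_def left_ideal_def)
    ultimately show False by auto
  qed
  then have "T = A" using J(3) TA by fastforce
  then show ?thesis using A by (simp add: semisimple_algebra_def T_def)
qed

section \<open>Multilinear forms and Sweedler calculus\<close>

named_theorems multilinear

context hopf_algebra
begin

text \<open>Linear forms and linear endomorphisms by their equations. The set \<open>multilinear\<close> proves
  multilinearity of Sweedler expressions by their syntax: each rule strips one operation around the
  single occurrence of the variable, and instances of \<open>form1_compose\<close>, \<open>form2_compose\<close> and
  \<open>form3_compose\<close> supply the given forms.\<close>

definition form1 :: "('h \<Rightarrow> 'k) \<Rightarrow> bool" where
  "form1 F \<longleftrightarrow> (\<forall>x y. F (x + y) = F x + F y) \<and> (\<forall>c x. F (c *s x) = c * F x)"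

definition form2 :: "('h \<Rightarrow> 'h \<Rightarrow> 'k) \<Rightarrow> bool" where
  "form2 F \<longleftrightarrow> (\<forall>b. form1 (\<lambda>a. F a b)) \<and> (\<forall>a. form1 (\<lambda>b. F a b))"

definition form3 :: "('h \<Rightarrow> 'h \<Rightarrow> 'h \<Rightarrow> 'k) \<Rightarrow> bool" where
  "form3 F \<longleftrightarrow> (\<forall>b c. form1 (\<lambda>a. F a b c)) \<and> (\<forall>a c. form1 (\<lambda>b. F a b c))
     \<and> (\<forall>a b. form1 (\<lambda>c. F a b c))"

definition endo :: "('h \<Rightarrow> 'h) \<Rightarrow> bool" where
  "endo g \<longleftrightarrow> (\<forall>x y. g (x + y) = g x + g y) \<and> (\<forall>c x. g (c *s x) = c *s g x)"

lemma form1_iff_dual: "form1 F \<longleftrightarrow> F \<in> dual"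
proof -
  have "vector_space ((*) :: 'k \<Rightarrow> 'k \<Rightarrow> 'k)"
    by unfold_locales (auto simp: algebra_simps)
  then show ?thesis
    using vector_space_axioms
    by (simp add: form1_def dual_def Vector_Spaces.linear_iff)
qed

lemma form2I [multilinear]:
  "(\<And>b. form1 (\<lambda>a. F a b)) \<Longrightarrow> (\<And>a. form1 (\<lambda>b. F a b)) \<Longrightarrow> form2 F"
  by (simp add: form2_def)

lemma form3I [multilinear]:
  "(\<And>b c. form1 (\<lambda>a. F a b c)) \<Longrightarrow> (\<And>a c. form1 (\<lambda>b. F a b c))
     \<Longrightarrow> (\<And>a b. form1 (\<lambda>c. F a b c)) \<Longrightarrow> form3 F"
  by (simp add: form3_def)

lemma form1_mult_left [multilinear]: "form1 F \<Longrightarrow> form1 (\<lambda>x. c * F x)"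
  by (simp add: form1_def algebra_simps)

lemma form1_mult_right [multilinear]: "form1 F \<Longrightarrow> form1 (\<lambda>x. F x * c)"
  by (simp add: form1_def algebra_simps)

lemma form1_pair_sum [multilinear]:
  "(\<And>a b. form1 (F a b)) \<Longrightarrow> form1 (\<lambda>x. \<Sum>(a, b)\<leftarrow>ts. F a b x)"
  by (simp add: form1_def pair_sum_add pair_sum_mult_left)

lemma form1_compose: "form1 F \<Longrightarrow> endo g \<Longrightarrow> form1 (\<lambda>x. F (g x))"
  by (simp add: form1_def endo_def)

lemma form2_compose_left: "form2 F \<Longrightarrow> endo g \<Longrightarrow> form1 (\<lambda>x. F (g x) b)"
  by (simp add: form2_def form1_def endo_def)

lemma form2_compose_right: "form2 F \<Longrightarrow> endo g \<Longrightarrow> form1 (\<lambda>x. F a (g x))"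
  by (simp add: form2_def form1_def endo_def)

lemma form3_compose:
  assumes "form3 F" "endo g"
  shows "form1 (\<lambda>x. F (g x) b c)" "form1 (\<lambda>x. F a (g x) c)" "form1 (\<lambda>x. F a b (g x))"
  using assms by (simp_all add: form3_def form1_def endo_def)

lemmas form2_compose = form2_compose_left form2_compose_right

lemma endo_id [multilinear]: "endo (\<lambda>x. x)"
  by (simp add: endo_def)

lemma endo_mult_left [multilinear]: "endo g \<Longrightarrow> endo (\<lambda>x. a * g x)"
  by (simp add: endo_def scale_mult_right algebra_simps)

lemma endo_mult_right [multilinear]: "endo g \<Longrightarrow> endo (\<lambda>x. g x * a)"
  by (simp add: endo_def scale_mult_left algebra_simps)

lemma S_add: "S (x + y) = S x + S y" and S_scale: "S (c *s x) = c *s S x"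
  using antipode_linear by (simp_all add: Vector_Spaces.linear_iff)

lemma endo_S [multilinear]: "endo g \<Longrightarrow> endo (\<lambda>x. S (g x))"
  by (simp add: endo_def S_add S_scale)

lemma counit_form: "form1 \<epsilon>"
  using counit_linear by (simp add: form1_iff_dual dual_def)

lemmas form1_counit [multilinear] = form1_compose[OF counit_form]

lemma tensor_eq_form2:
  assumes "tensor_eq scale UNIV (pair_words ts) (pair_words us)" "form2 F"
  shows "(\<Sum>(a, b)\<leftarrow>ts. F a b) = (\<Sum>(a, b)\<leftarrow>us. F a b)"
proof (rule tensor_eq_eval_pairs[OF _ assms(1)])
  show "vector_space ((*) :: 'k \<Rightarrow> 'k \<Rightarrow> 'k)"
    by unfold_locales (auto simp: algebra_simps)
qed (use assms(2) in \<open>auto simp: form2_def form1_def\<close>)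

lemma tensor_eq_form3:
  assumes "tensor_eq scale UNIV ts us" "form3 F"
    and "\<And>w. \<phi> w = (if length w = 3 then F (w ! 0) (w ! 1) (w ! 2) else 0)"
  shows "(\<Sum>w\<leftarrow>ts. \<phi> w) = (\<Sum>w\<leftarrow>us. \<phi> w)"
  using assms(2,3) by (intro tensor_eq_eval_triples[OF assms(1), of F]) (auto simp: form3_def form1_def)

lemma comult_add_form:
  "form2 F \<Longrightarrow> (\<Sum>(a, b)\<leftarrow>\<Delta> (x + y). F a b) = (\<Sum>(a, b)\<leftarrow>\<Delta> x. F a b) + (\<Sum>(a, b)\<leftarrow>\<Delta> y. F a b)"
  using tensor_eq_form2[of "\<Delta> (x + y)" "\<Delta> x @ \<Delta> y" F] comult_add[of x y]
  by (simp add: pair_words_def)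

lemma comult_scale_form:
  assumes "form2 F"
  shows "(\<Sum>(a, b)\<leftarrow>\<Delta> (c *s x). F a b) = c * (\<Sum>(a, b)\<leftarrow>\<Delta> x. F a b)"
proof -
  have "pair_words (map (\<lambda>(a, b). (c *s a, b)) (\<Delta> x)) = [[c *s a, b]. (a, b) \<leftarrow> \<Delta> x]"
    by (simp add: pair_words_def case_prod_unfold o_def)
  with tensor_eq_form2[of "\<Delta> (c *s x)" "map (\<lambda>(a, b). (c *s a, b)) (\<Delta> x)" F] comult_scale[of c x] assms
  have "(\<Sum>(a, b)\<leftarrow>\<Delta> (c *s x). F a b) = (\<Sum>(a, b)\<leftarrow>\<Delta> x. F (c *s a) b)"
    by (simp add: case_prod_unfold o_def)
  then show ?thesis
    using assms by (simp add: form2_def form1_def pair_sum_mult_left)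
qed

lemma form1_comult [multilinear]:
  "form2 F \<Longrightarrow> endo g \<Longrightarrow> form1 (\<lambda>x. \<Sum>(a, b)\<leftarrow>\<Delta> (g x). F a b)"
  by (simp add: form1_def endo_def comult_add_form comult_scale_form)

lemma coassoc_form:
  assumes "form3 F"
  shows "(\<Sum>(a, b)\<leftarrow>\<Delta> h. \<Sum>(c, d)\<leftarrow>\<Delta> a. F c d b) = (\<Sum>(a, b)\<leftarrow>\<Delta> h. \<Sum>(c, d)\<leftarrow>\<Delta> b. F a c d)"
proof -
  note * = tensor_eq_form3[OF coassoc[of h] assms refl]
  show ?thesis
    using * by (simp add: sum_list_concat_pairs case_prod_unfold o_def)
qed

lemma counit_left_form:
  assumes "form1 F"
  shows "(\<Sum>(a, b)\<leftarrow>\<Delta> h. \<epsilon> a * F b) = F h"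
proof -
  have "F (\<Sum>(a, b)\<leftarrow>ts. \<epsilon> a *s b) = (\<Sum>(a, b)\<leftarrow>ts. \<epsilon> a * F b)" for ts
  proof (induction ts)
    case Nil
    then show ?case using assms scale_zero_left by (metis form1_def list.map(1) mult_zero_left sum_list.Nil)
  qed (use assms in \<open>auto simp: form1_def\<close>)
  from this[of "\<Delta> h"] show ?thesis by (simp add: counit_left)
qed

lemma form1_zero: "form1 F \<Longrightarrow> F 0 = 0"
  by (metis form1_def mult_zero_left scale_zero_left)

lemma form1_of_pair_sum:
  "form1 F \<Longrightarrow> F (\<Sum>(a, b)\<leftarrow>ts. g a b) = (\<Sum>(a, b)\<leftarrow>ts. F (g a b))"
  by (induction ts) (auto simp: form1_zero, auto simp: form1_def)

lemma counit_right_form: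
  assumes "form1 F"
  shows "(\<Sum>(a, b)\<leftarrow>\<Delta> h. \<epsilon> b * F a) = F h"
  using form1_of_pair_sum[OF assms, of "\<lambda>a b. \<epsilon> b *s a" "\<Delta> h"] assms
  by (simp add: counit_right form1_def)

lemma comult_mult_form:
  assumes "form2 F"
  shows "(\<Sum>(a, b)\<leftarrow>\<Delta> (x * y). F a b) = (\<Sum>(a, b)\<leftarrow>\<Delta> x. \<Sum>(c, d)\<leftarrow>\<Delta> y. F (a * c) (b * d))"
  using tensor_eq_form2[OF comult_mult[of x y] assms]
  by (simp add: tensor_mult_def sum_list_concat_pairs case_prod_unfold o_def)

lemma comult_one_form: "form2 F \<Longrightarrow> (\<Sum>(a, b)\<leftarrow>\<Delta> 1. F a b) = F 1 1"
  using tensor_eq_form2[of "\<Delta> 1" "[(1, 1)]" F] comult_one by (simp add: pair_words_def)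

lemma antipode_left_form: "form1 F \<Longrightarrow> (\<Sum>(a, b)\<leftarrow>\<Delta> h. F (S a * b)) = \<epsilon> h * F 1"
  using form1_of_pair_sum[of F "\<lambda>a b. S a * b" "\<Delta> h"] by (simp add: antipode_left form1_def)

lemma antipode_right_form: "form1 F \<Longrightarrow> (\<Sum>(a, b)\<leftarrow>\<Delta> h. F (a * S b)) = \<epsilon> h * F 1"
  using form1_of_pair_sum[of F "\<lambda>a b. a * S b" "\<Delta> h"] by (simp add: antipode_right form1_def)

text \<open>Collapsing an antipode next to its argument inside a longer Sweedler sum.\<close>

lemma antipode_left_tail:
  assumes "form2 F"
  shows "(\<Sum>(a, b)\<leftarrow>\<Delta> h. \<Sum>(c, d)\<leftarrow>\<Delta> b. F a (S c * d)) = F h 1"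
proof -
  have "(\<Sum>(a, b)\<leftarrow>\<Delta> h. \<Sum>(c, d)\<leftarrow>\<Delta> b. F a (S c * d)) = (\<Sum>(a, b)\<leftarrow>\<Delta> h. \<epsilon> b * F a 1)"
    using assms by (intro pair_sum_cong antipode_left_form[of "F _"]) (simp add: form2_def)
  also have "\<dots> = F h 1"
    using assms by (intro counit_right_form[of "\<lambda>a. F a 1"]) (simp add: form2_def)
  finally show ?thesis .
qed

lemma antipode_right_tail:
  assumes "form2 F"
  shows "(\<Sum>(a, b)\<leftarrow>\<Delta> h. \<Sum>(c, d)\<leftarrow>\<Delta> b. F a (c * S d)) = F h 1"
proof -
  have "(\<Sum>(a, b)\<leftarrow>\<Delta> h. \<Sum>(c, d)\<leftarrow>\<Delta> b. F a (c * S d)) = (\<Sum>(a, b)\<leftarrow>\<Delta> h. \<epsilon> b * F a 1)"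
    using assms by (intro pair_sum_cong antipode_right_form[of "F _"]) (simp add: form2_def)
  also have "\<dots> = F h 1"
    using assms by (intro counit_right_form[of "\<lambda>a. F a 1"]) (simp add: form2_def)
  finally show ?thesis .
qed

lemma antipode_left_head:
  assumes "form2 F"
  shows "(\<Sum>(a, b)\<leftarrow>\<Delta> h. \<Sum>(c, d)\<leftarrow>\<Delta> a. F (S c * d) b) = F 1 h"
proof -
  have "(\<Sum>(a, b)\<leftarrow>\<Delta> h. \<Sum>(c, d)\<leftarrow>\<Delta> a. F (S c * d) b) = (\<Sum>(a, b)\<leftarrow>\<Delta> h. \<epsilon> a * F 1 b)"
    using assms by (intro pair_sum_cong antipode_left_form[of "\<lambda>x. F x _"]) (simp add: form2_def)
  also have "\<dots> = F 1 h"
    using assms by (intro counit_left_form[of "F 1"]) (simp add: form2_def)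
  finally show ?thesis .
qed

lemma antipode_right_head:
  assumes "form2 F"
  shows "(\<Sum>(a, b)\<leftarrow>\<Delta> h. \<Sum>(c, d)\<leftarrow>\<Delta> a. F (c * S d) b) = F 1 h"
proof -
  have "(\<Sum>(a, b)\<leftarrow>\<Delta> h. \<Sum>(c, d)\<leftarrow>\<Delta> a. F (c * S d) b) = (\<Sum>(a, b)\<leftarrow>\<Delta> h. \<epsilon> a * F 1 b)"
    using assms by (intro pair_sum_cong antipode_right_form[of "\<lambda>x. F x _"]) (simp add: form2_def)
  also have "\<dots> = F 1 h"
    using assms by (intro counit_left_form[of "F 1"]) (simp add: form2_def)
  finally show ?thesis .
qed

text \<open>Linear forms separate points, so identities between elements may be tested on forms.\<close>

lemma eq_by_forms:
  assumes "\<And>F. form1 F \<Longrightarrow> F x = F y"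
  shows "x = y"
proof -
  define B where "B = extend_basis {}"
  have ind: "independent B" and span: "span B = UNIV"
    using independent_extend_basis[OF independent_empty] span_extend_basis[OF independent_empty]
    by (simp_all add: B_def)
  have "representation B x b = representation B y b" for b
    using ind span
    by (intro assms) (simp add: form1_def representation_add representation_scale)
  then have "representation B x = representation B y" by blast
  then show ?thesis
    using sum_nonzero_representation_eq[OF ind] span by (metis UNIV_I)
qed


text \<open>Both sides are convolution inverses of the product \<open>x \<otimes> y \<mapsto> x y\<close>: the sum
  \<open>\<Sum> S(x\<^sub>1 y\<^sub>1) x\<^sub>2 y\<^sub>2 S(y\<^sub>3) S(x\<^sub>3)\<close> collapses from the right to one and from the left to the other.\<close>

lemma S_mult: "S (x * y) = S y * S x"
proof (rule eq_by_forms)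
  fix F assume F: "form1 F"
  note [multilinear] = form1_compose[OF F]
  let ?T = "\<lambda>a b1 b2. \<Sum>(c, d)\<leftarrow>\<Delta> y. \<Sum>(d1, d2)\<leftarrow>\<Delta> d. F (S (a * c) * (b1 * d1) * (S d2 * S b2))"
  have inner: "?T a b1 b2 = F (S (a * y) * (b1 * S b2))" for a b1 b2
    using antipode_right_tail[of "\<lambda>c z. F (S (a * c) * b1 * z * S b2)" y]
    by (simp add: mult.assoc) (simp add: multilinear)
  have "(\<Sum>(a, b)\<leftarrow>\<Delta> x. \<Sum>(b1, b2)\<leftarrow>\<Delta> b. ?T a b1 b2)
      = (\<Sum>(a, b)\<leftarrow>\<Delta> x. \<Sum>(b1, b2)\<leftarrow>\<Delta> b. F (S (a * y) * (b1 * S b2)))"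
    by (simp only: inner)
  also have "\<dots> = F (S (x * y))"
    using antipode_right_tail[of "\<lambda>a z. F (S (a * y) * z)" x] by (simp add: multilinear)
  finally have T1: "(\<Sum>(a, b)\<leftarrow>\<Delta> x. \<Sum>(b1, b2)\<leftarrow>\<Delta> b. ?T a b1 b2) = F (S (x * y))" .
  have inner: "?T a b1 b2 = (\<Sum>(c, d)\<leftarrow>\<Delta> y. \<Sum>(c1, c2)\<leftarrow>\<Delta> c. F (S (a * c1) * (b1 * c2) * (S d * S b2)))"
    for a b1 b2
    by (rule coassoc_form[symmetric]) (intro multilinear)
  have "(\<Sum>(a, b)\<leftarrow>\<Delta> x. \<Sum>(b1, b2)\<leftarrow>\<Delta> b. ?T a b1 b2)
      = (\<Sum>(a, b)\<leftarrow>\<Delta> x. \<Sum>(a1, a2)\<leftarrow>\<Delta> a. ?T a1 a2 b)"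
    by (rule coassoc_form[symmetric]) (intro multilinear)
  also have "\<dots> = (\<Sum>(a, b)\<leftarrow>\<Delta> x. \<Sum>(c, d)\<leftarrow>\<Delta> y. \<Sum>(a1, a2)\<leftarrow>\<Delta> a. \<Sum>(c1, c2)\<leftarrow>\<Delta> c.
      F (S (a1 * c1) * (a2 * c2) * (S d * S b)))"
    unfolding inner by (intro pair_sum_cong pair_sum_swap)
  also have "\<dots> = (\<Sum>(a, b)\<leftarrow>\<Delta> x. \<Sum>(c, d)\<leftarrow>\<Delta> y. \<Sum>(u, v)\<leftarrow>\<Delta> (a * c). F (S u * v * (S d * S b)))"
    by (intro pair_sum_cong comult_mult_form[symmetric] multilinear)
  also have "\<dots> = (\<Sum>(a, b)\<leftarrow>\<Delta> x. \<Sum>(c, d)\<leftarrow>\<Delta> y. \<epsilon> (a * c) * F (1 * (S d * S b)))"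
    by (intro pair_sum_cong antipode_left_form[of "\<lambda>z. F (z * _)"] multilinear)
  also have "\<dots> = (\<Sum>(a, b)\<leftarrow>\<Delta> x. \<epsilon> a * F (S y * S b))"
    using counit_left_form[of "\<lambda>d. \<epsilon> _ * F (S d * S _)" y]
    by (simp add: counit_mult mult.left_commute multilinear mult.assoc)
  also have "\<dots> = F (S y * S x)"
    by (intro counit_left_form multilinear)
  finally show "F (S (x * y)) = F (S y * S x)"
    using T1 by simp
qed

lemma S_one: "S 1 = 1"
proof (rule eq_by_forms)
  fix F assume F: "form1 F"
  note [multilinear] = form1_compose[OF F]
  have "F (S 1 * 1) = (\<Sum>(a, b)\<leftarrow>\<Delta> 1. F (S a * b))"
    by (rule comult_one_form[symmetric]) (intro multilinear)
  also have "\<dots> = \<epsilon> 1 * F 1" by (rule antipode_left_form[OF F])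
  finally show "F (S 1) = F 1" by (simp add: counit_one)
qed

lemma counit_S: "\<epsilon> (S h) = \<epsilon> h"
proof -
  have "\<epsilon> (S h) = (\<Sum>(a, b)\<leftarrow>\<Delta> h. \<epsilon> b * \<epsilon> (S a))"
    by (rule counit_right_form[symmetric]) (intro multilinear)
  also have "\<dots> = (\<Sum>(a, b)\<leftarrow>\<Delta> h. \<epsilon> (S a * b))"
    by (simp only: counit_mult mult.commute)
  also have "\<dots> = \<epsilon> h"
    using antipode_left_form[OF counit_form, of h] by (simp add: counit_one)
  finally show ?thesis .
qed

text \<open>The same argument in \<open>H \<otimes> H\<close>: the sum \<open>\<Sum> \<Delta>(S(h\<^sub>1)) \<Delta>(h\<^sub>2) (S(h\<^sub>4) \<otimes> S(h\<^sub>3))\<close> collapses to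
  \<open>\<Delta>(S h)\<close> from the right and to \<open>\<Sum> S(h\<^sub>2) \<otimes> S(h\<^sub>1)\<close> from the left.\<close>

lemma comult_S_form:
  assumes F: "form2 F"
  shows "(\<Sum>(a, b)\<leftarrow>\<Delta> (S h). F a b) = (\<Sum>(a, b)\<leftarrow>\<Delta> h. F (S b) (S a))"
proof -
  note [multilinear] = form2_compose[OF F]
  let ?G = "\<lambda>p q. \<lambda>c1 c2 d1 d2. F (p * c1 * S d2) (q * c2 * S d1)"
  have collapse: "(\<Sum>(c, d)\<leftarrow>\<Delta> b. \<Sum>(c1, c2)\<leftarrow>\<Delta> c. \<Sum>(d1, d2)\<leftarrow>\<Delta> d. ?G p q c1 c2 d1 d2) = \<epsilon> b * F p q"
    for p q b
  proof -
    have "(\<Sum>(c, d)\<leftarrow>\<Delta> b. \<Sum>(c1, c2)\<leftarrow>\<Delta> c. \<Sum>(d1, d2)\<leftarrow>\<Delta> d. ?G p q c1 c2 d1 d2)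
        = (\<Sum>(a, b)\<leftarrow>\<Delta> b. \<Sum>(c, d)\<leftarrow>\<Delta> b. \<Sum>(d1, d2)\<leftarrow>\<Delta> d. ?G p q a c d1 d2)"
      by (rule coassoc_form) (intro multilinear)
    also have "\<dots> = (\<Sum>(a, b)\<leftarrow>\<Delta> b. \<Sum>(c, d)\<leftarrow>\<Delta> b. \<Sum>(c1, c2)\<leftarrow>\<Delta> c. ?G p q a c1 c2 d)"
      by (intro pair_sum_cong coassoc_form[symmetric] multilinear)
    also have "\<dots> = (\<Sum>(a, b)\<leftarrow>\<Delta> b. F (p * a * S b) (q * 1))"
      using antipode_right_head[of "\<lambda>x d. F (p * _ * S d) (q * x)"]
      by (simp add: mult.assoc) (simp add: multilinear)
    also have "\<dots> = \<epsilon> b * F (p * 1) q"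
      using antipode_right_form[of "\<lambda>x. F (p * x) q"] by (simp add: mult.assoc multilinear)
    finally show ?thesis by simp
  qed
  have "(\<Sum>(a, b)\<leftarrow>\<Delta> (S h). F a b) = (\<Sum>(a, b)\<leftarrow>\<Delta> h. \<epsilon> b * (\<Sum>(p, q)\<leftarrow>\<Delta> (S a). F p q))"
    by (rule counit_right_form[symmetric]) (intro multilinear)
  also have "\<dots> = (\<Sum>(a, b)\<leftarrow>\<Delta> h. \<Sum>(p, q)\<leftarrow>\<Delta> (S a). \<Sum>(c, d)\<leftarrow>\<Delta> b. \<Sum>(c1, c2)\<leftarrow>\<Delta> c. \<Sum>(d1, d2)\<leftarrow>\<Delta> d.
      ?G p q c1 c2 d1 d2)"
    by (simp only: collapse pair_sum_mult_left)
  also have "\<dots> = (\<Sum>(a, b)\<leftarrow>\<Delta> h. \<Sum>(c, d)\<leftarrow>\<Delta> b. \<Sum>(d1, d2)\<leftarrow>\<Delta> d. \<Sum>(p, q)\<leftarrow>\<Delta> (S a). \<Sum>(c1, c2)\<leftarrow>\<Delta> c.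
      ?G p q c1 c2 d1 d2)"
  proof (rule pair_sum_cong, goal_cases)
    case (1 a b)
    show ?case
      by (rule trans[OF pair_sum_swap], rule pair_sum_cong,
          rule trans[OF pair_sum_cong[OF pair_sum_swap]], rule pair_sum_swap)
  qed
  also have "\<dots> = (\<Sum>(a, b)\<leftarrow>\<Delta> h. \<Sum>(c, d)\<leftarrow>\<Delta> b. \<Sum>(d1, d2)\<leftarrow>\<Delta> d. \<Sum>(u, v)\<leftarrow>\<Delta> (S a * c).
      F (u * S d2) (v * S d1))"
    by (intro pair_sum_cong comult_mult_form[symmetric] multilinear)
  also have "\<dots> = (\<Sum>(d1, d2)\<leftarrow>\<Delta> h. \<Sum>(u, v)\<leftarrow>\<Delta> 1. F (u * S d2) (v * S d1))"
  proof -
    let ?K = "\<lambda>x d. \<Sum>(d1, d2)\<leftarrow>\<Delta> d. \<Sum>(u, v)\<leftarrow>\<Delta> x. F (u * S d2) (v * S d1)"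
    have "(\<Sum>(a, b)\<leftarrow>\<Delta> h. \<Sum>(c, d)\<leftarrow>\<Delta> b. ?K (S a * c) d)
        = (\<Sum>(a, b)\<leftarrow>\<Delta> h. \<Sum>(c, d)\<leftarrow>\<Delta> a. ?K (S c * d) b)"
      by (rule coassoc_form[symmetric]) (intro multilinear)
    also have "\<dots> = ?K 1 h"
      by (rule antipode_left_head) (intro multilinear)
    finally show ?thesis .
  qed
  also have "\<dots> = (\<Sum>(d1, d2)\<leftarrow>\<Delta> h. F (1 * S d2) (1 * S d1))"
    by (intro pair_sum_cong comult_one_form multilinear)
  finally show ?thesis by simp
qed


section \<open>The adjoint action\<close>

lemma adj_form: "form1 F \<Longrightarrow> F (adj h x) = (\<Sum>(a, b)\<leftarrow>\<Delta> h. F (a * x * S b))"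
  unfolding adj_def by (rule form1_of_pair_sum)

lemma endo_by_forms: "(\<And>F. form1 F \<Longrightarrow> form1 (\<lambda>x. F (g x))) \<Longrightarrow> endo g"
  unfolding endo_def by (intro conjI allI eq_by_forms) (auto simp: form1_def)

lemma endo_adj_left [multilinear]:
  assumes "endo g"
  shows "endo (\<lambda>x. adj (g x) y)"
proof (rule endo_by_forms)
  fix F assume F: "form1 F"
  note [multilinear] = form1_compose[OF F]
  show "form1 (\<lambda>x. F (adj (g x) y))"
    unfolding adj_form[OF F] using assms by (intro multilinear)
qed

lemma endo_adj_right [multilinear]:
  assumes "endo g"
  shows "endo (\<lambda>x. adj h (g x))"
proof (rule endo_by_forms)
  fix F assume F: "form1 F"
  note [multilinear] = form1_compose[OF F]
  show "form1 (\<lambda>x. F (adj h (g x)))"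
    unfolding adj_form[OF F] using assms by (intro multilinear)
qed

lemma adj_one: "adj 1 x = x"
proof (rule eq_by_forms)
  fix F assume F: "form1 F"
  note [multilinear] = form1_compose[OF F]
  show "F (adj 1 x) = F x"
    unfolding adj_form[OF F] using comult_one_form[of "\<lambda>a b. F (a * x * S b)"]
    by (simp add: S_one multilinear)
qed

lemma adj_mult: "adj (h * g) x = adj h (adj g x)"
proof (rule eq_by_forms)
  fix F assume F: "form1 F"
  note [multilinear] = form1_compose[OF F]
  have "F (adj (h * g) x) = (\<Sum>(a, b)\<leftarrow>\<Delta> h. \<Sum>(c, d)\<leftarrow>\<Delta> g. F (a * c * x * S (b * d)))"
    unfolding adj_form[OF F] by (rule comult_mult_form) (intro multilinear)
  also have "\<dots> = (\<Sum>(a, b)\<leftarrow>\<Delta> h. F (a * adj g x * S b))"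
    by (intro pair_sum_cong, subst adj_form[of "\<lambda>z. F (_ * z * _)"])
      (intro multilinear, simp add: S_mult mult.assoc)
  also have "\<dots> = F (adj h (adj g x))"
    by (simp only: adj_form[OF F])
  finally show "F (adj (h * g) x) = F (adj h (adj g x))" .
qed

lemma counit_adj: "\<epsilon> (adj h x) = \<epsilon> h * \<epsilon> x"
proof -
  have "\<epsilon> (adj h x) = (\<Sum>(a, b)\<leftarrow>\<Delta> h. \<epsilon> b * \<epsilon> (a * x))"
    unfolding adj_form[OF counit_form] by (simp add: counit_mult counit_S mult_ac)
  also have "\<dots> = \<epsilon> h * \<epsilon> x"
    using counit_right_form[of "\<lambda>a. \<epsilon> (a * x)" h] by (simp add: multilinear counit_mult)
  finally show ?thesis .
qed

text \<open>The antipode in the action cancels against the factor that follows: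
  \<open>\<Sum> h\<^sub>1 z S(h\<^sub>2) h\<^sub>3 = h z\<close>.\<close>

lemma adj_mult_cancel:
  assumes F: "form1 F"
  shows "(\<Sum>(a, b)\<leftarrow>\<Delta> h. F (adj a z * b)) = F (h * z)"
proof -
  note [multilinear] = form1_compose[OF F]
  have "(\<Sum>(a, b)\<leftarrow>\<Delta> h. F (adj a z * b)) = (\<Sum>(a, b)\<leftarrow>\<Delta> h. \<Sum>(c, d)\<leftarrow>\<Delta> a. F (c * z * (S d * b)))"
    by (intro pair_sum_cong, subst adj_form[of "\<lambda>x. F (x * _)"])
      (intro multilinear, simp add: mult.assoc)
  also have "\<dots> = (\<Sum>(a, b)\<leftarrow>\<Delta> h. \<Sum>(c, d)\<leftarrow>\<Delta> b. F (a * z * (S c * d)))"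
    by (rule coassoc_form) (intro multilinear)
  also have "\<dots> = F (h * z * 1)"
    by (rule antipode_left_tail) (intro multilinear)
  finally show ?thesis by simp
qed

text \<open>In \<open>\<Delta>(\<Sum> h\<^sub>1 x S(h\<^sub>2)) = \<Sum> h\<^sub>1 x\<^sub>1 S(h\<^sub>4) \<otimes> h\<^sub>2 x\<^sub>2 S(h\<^sub>3)\<close> the two inner components of \<open>h\<close> regroup to
  an adjoint action. In this form \<open>\<Delta>\<^sub>R(h \<cdot> x)\<close> contains \<open>R \<Delta>(h\<^sub>2)\<close>, to which the intertwining property
  of \<open>R\<close> applies.\<close>

lemma comult_adj_form:
  assumes F: "form2 F"
  shows "(\<Sum>(u, v)\<leftarrow>\<Delta> (adj h x). F u v)
      = (\<Sum>(a, b)\<leftarrow>\<Delta> h. \<Sum>(c, d)\<leftarrow>\<Delta> b. \<Sum>(u, v)\<leftarrow>\<Delta> x. F (a * u * S d) (adj c v))"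
proof -
  note [multilinear] = form2_compose[OF F]
  let ?G = "\<lambda>a b c d. \<Sum>(u, v)\<leftarrow>\<Delta> x. F (a * u * S d) (b * v * S c)"
  have "(\<Sum>(u, v)\<leftarrow>\<Delta> (adj h x). F u v) = (\<Sum>(a, b)\<leftarrow>\<Delta> h. \<Sum>(u, v)\<leftarrow>\<Delta> (a * x * S b). F u v)"
    by (rule adj_form) (intro multilinear)
  also have "\<dots> = (\<Sum>(a, b)\<leftarrow>\<Delta> h. \<Sum>(a1, a2)\<leftarrow>\<Delta> a. \<Sum>(u, v)\<leftarrow>\<Delta> x. \<Sum>(c, d)\<leftarrow>\<Delta> b.
      F (a1 * u * S d) (a2 * v * S c))"
  proof (rule pair_sum_cong, goal_cases)
    case (1 a b)
    have "(\<Sum>(u, v)\<leftarrow>\<Delta> (a * x * S b). F u v)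
        = (\<Sum>(u, v)\<leftarrow>\<Delta> (a * x). \<Sum>(c, d)\<leftarrow>\<Delta> (S b). F (u * c) (v * d))"
      by (rule comult_mult_form[OF F])
    also have "\<dots> = (\<Sum>(u, v)\<leftarrow>\<Delta> (a * x). \<Sum>(c, d)\<leftarrow>\<Delta> b. F (u * S d) (v * S c))"
      by (intro pair_sum_cong comult_S_form multilinear)
    also have "\<dots> = (\<Sum>(a1, a2)\<leftarrow>\<Delta> a. \<Sum>(u, v)\<leftarrow>\<Delta> x. \<Sum>(c, d)\<leftarrow>\<Delta> b. F (a1 * u * S d) (a2 * v * S c))"
      by (intro comult_mult_form multilinear)
    finally show ?case .
  qed
  also have "\<dots> = (\<Sum>(a, b)\<leftarrow>\<Delta> h. \<Sum>(a1, a2)\<leftarrow>\<Delta> a. \<Sum>(c, d)\<leftarrow>\<Delta> b. ?G a1 a2 c d)"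
    by (intro pair_sum_cong pair_sum_swap)
  also have "\<dots> = (\<Sum>(a, b)\<leftarrow>\<Delta> h. \<Sum>(a1, a2)\<leftarrow>\<Delta> b. \<Sum>(c, d)\<leftarrow>\<Delta> a2. ?G a a1 c d)"
    by (rule coassoc_form) (intro multilinear)
  also have "\<dots> = (\<Sum>(a, b)\<leftarrow>\<Delta> h. \<Sum>(e, d)\<leftarrow>\<Delta> b. \<Sum>(b, c)\<leftarrow>\<Delta> e. ?G a b c d)"
    by (intro pair_sum_cong coassoc_form[symmetric] multilinear)
  also have "\<dots> = (\<Sum>(a, b)\<leftarrow>\<Delta> h. \<Sum>(c, d)\<leftarrow>\<Delta> b. \<Sum>(u, v)\<leftarrow>\<Delta> x. F (a * u * S d) (adj c v))"
    by (intro pair_sum_cong, subst adj_form[of "F _"], (intro multilinear)[1], rule pair_sum_swap)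
  finally show ?thesis .
qed

end

section \<open>Integrals\<close>

context hopf_algebra
begin

text \<open>The two-sided integrals of \<open>H\<^sup>*\<close>, tested against forms.\<close>

definition biinvariant :: "('h \<Rightarrow> 'k) \<Rightarrow> bool" where
  "biinvariant l \<longleftrightarrow> form1 l \<and>
     (\<forall>F h. form1 F \<longrightarrow> (\<Sum>(a, b)\<leftarrow>\<Delta> h. F a * l b) = F 1 * l h \<and>
                        (\<Sum>(a, b)\<leftarrow>\<Delta> h. l a * F b) = l h * F 1)"

lemma biinvariant_form: "biinvariant l \<Longrightarrow> form1 l"
  and biinvariant_left: "biinvariant l \<Longrightarrow> form1 F \<Longrightarrow> (\<Sum>(a, b)\<leftarrow>\<Delta> h. F a * l b) = F 1 * l h"
  and biinvariant_right: "biinvariant l \<Longrightarrow> form1 F \<Longrightarrow> (\<Sum>(a, b)\<leftarrow>\<Delta> h. l a * F b) = l h * F 1"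
  by (simp_all add: biinvariant_def)

text \<open>If \<open>\<lambda>\<close> is a left integral, then \<open>\<lambda> \<circ> S\<close> is a right one, and the product of the two in \<open>H\<^sup>*\<close>
  equals both, since they are \<open>1\<close> at the unit. The other case is symmetric. That \<open>\<lambda> \<circ> S\<close> is a
  right integral follows at first only against forms \<open>F \<circ> S\<close>; expanding \<open>S(h\<^sub>2) h\<^sub>3\<close> gives it for
  all forms without inverting \<open>S\<close>.\<close>

lemma dual_integral_biinvariant:
  assumes "dual_integral l" and l1: "l 1 = 1"
  shows "biinvariant l"
proof -
  have l: "form1 l"
    using assms by (auto simp: dual_integral_def dual_left_integral_def dual_right_integral_def form1_iff_dual)
  note [multilinear] = form1_compose[OF l]
  consider (left) "dual_left_integral l" | (right) "dual_right_integral l"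
    using assms by (auto simp: dual_integral_def)
  then show ?thesis
  proof cases
    case left
    have L: "(\<Sum>(a, b)\<leftarrow>\<Delta> h. F a * l b) = F 1 * l h" if "form1 F" for F h
      using left that
      by (auto simp: dual_left_integral_def form1_iff_dual convolution_def dual_scale_def dest!: bspec fun_cong)
    have R': "(\<Sum>(a, b)\<leftarrow>\<Delta> h. l (S a) * F b) = l (S h) * F 1" if F: "form1 F" for F h
    proof -
      note [multilinear] = form1_compose[OF F]
      have "(\<Sum>(a, b)\<leftarrow>\<Delta> h. l (S a) * F b) = (\<Sum>(a, b)\<leftarrow>\<Delta> h. \<Sum>(c, d)\<leftarrow>\<Delta> a. F (S d * b) * l (S c))"
      proof (rule pair_sum_cong, goal_cases)
        case (1 a b)
        have "(\<Sum>(c, d)\<leftarrow>\<Delta> a. F (S d * b) * l (S c)) = (\<Sum>(c, d)\<leftarrow>\<Delta> (S a). F (c * b) * l d)"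
          by (rule comult_S_form[symmetric]) (intro multilinear)
        also have "\<dots> = F (1 * b) * l (S a)"
          by (rule L) (intro multilinear)
        finally show ?case by (simp add: mult.commute)
      qed
      also have "\<dots> = (\<Sum>(a, b)\<leftarrow>\<Delta> h. \<Sum>(c, d)\<leftarrow>\<Delta> b. F (S c * d) * l (S a))"
        by (rule coassoc_form) (intro multilinear)
      also have "\<dots> = F 1 * l (S h)"
        by (rule antipode_left_tail) (intro multilinear)
      finally show ?thesis by (simp add: mult.commute)
    qed
    have "form1 (\<lambda>x. l (S x))" by (intro multilinear)
    from L[OF this] R'[OF l] have "l (S h) = l h" for h
      by (simp add: S_one l1)
    then show ?thesis
      using l L R' by (simp add: biinvariant_def)
  next
    case right
    have R: "(\<Sum>(a, b)\<leftarrow>\<Delta> h. l a * F b) = l h * F 1" if "form1 F" for F h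
      using right that
      by (auto simp: dual_right_integral_def form1_iff_dual convolution_def dual_scale_def mult.commute
          dest!: bspec fun_cong)
    have L': "(\<Sum>(a, b)\<leftarrow>\<Delta> h. F a * l (S b)) = F 1 * l (S h)" if F: "form1 F" for F h
    proof -
      note [multilinear] = form1_compose[OF F]
      have "(\<Sum>(a, b)\<leftarrow>\<Delta> h. F a * l (S b)) = (\<Sum>(a, b)\<leftarrow>\<Delta> h. \<Sum>(c, d)\<leftarrow>\<Delta> b. l (S d) * F (a * S c))"
      proof (rule pair_sum_cong, goal_cases)
        case (1 a b)
        have "(\<Sum>(c, d)\<leftarrow>\<Delta> b. l (S d) * F (a * S c)) = (\<Sum>(c, d)\<leftarrow>\<Delta> (S b). l c * F (a * d))"
          by (rule comult_S_form[symmetric]) (intro multilinear)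
        also have "\<dots> = l (S b) * F (a * 1)"
          by (rule R) (intro multilinear)
        finally show ?case by (simp add: mult.commute)
      qed
      also have "\<dots> = (\<Sum>(a, b)\<leftarrow>\<Delta> h. \<Sum>(c, d)\<leftarrow>\<Delta> a. l (S b) * F (c * S d))"
        by (rule coassoc_form[symmetric]) (intro multilinear)
      also have "\<dots> = l (S h) * F 1"
        by (rule antipode_right_head) (intro multilinear)
      finally show ?thesis by (simp add: mult.commute)
    qed
    have "form1 (\<lambda>x. l (S x))" by (intro multilinear)
    from R[OF this] L'[OF l] have "l (S h) = l h" for h
      by (simp add: S_one l1)
    then show ?thesis
      using l L' R by (simp add: biinvariant_def)
  qed
qed

lemma form1_of_sum: "form1 F \<Longrightarrow> F (\<Sum>i\<in>I. g i) = (\<Sum>i\<in>I. F (g i))"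
  by (induction I rule: infinite_finite_induct) (auto simp: form1_zero, auto simp: form1_def)

lemma dual_basis:
  assumes finite_dimensional
  obtains B and c :: "'h \<Rightarrow> 'h \<Rightarrow> 'k"
  where "finite B" "\<And>i. form1 (c i)" "\<And>F x. form1 F \<Longrightarrow> F x = (\<Sum>i\<in>B. c i x * F i)"
proof -
  obtain B0 where B0: "finite B0" "span B0 = UNIV"
    using assms by (auto simp: finite_dimensional_def)
  obtain B where B: "B \<subseteq> B0" "independent B" "B0 \<subseteq> span B"
    by (rule maximal_independent_subset)
  have fin: "finite B" using B(1) B0(1) by (rule finite_subset)
  have span: "span B = UNIV"
    using span_minimal[OF B(3) subspace_span] B0(2) by auto
  define c where "c i x = representation B x i" for i x
  have c: "form1 (c i)" for i
    using span B(2) by (simp add: c_def form1_def representation_add representation_scale)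
  have basis: "(\<Sum>i\<in>B. c i x *s i) = x" for x
    unfolding c_def using sum_representation_eq[OF B(2) _ fin subset_refl] span by simp
  have "F x = (\<Sum>i\<in>B. c i x * F i)" if F: "form1 F" for F x
  proof -
    have "F (\<Sum>i\<in>B. c i x *s i) = (\<Sum>i\<in>B. c i x * F i)"
      unfolding form1_of_sum[OF F] using F by (simp add: form1_def)
    then show ?thesis by (simp add: basis)
  qed
  with fin c show ?thesis by (rule that)
qed

text \<open>The trace formula for an integral: \<open>F(\<Lambda>)\<close> is the trace of \<open>x \<mapsto> \<Sum> F(x\<^sub>1) S\<^sup>2(x\<^sub>2)\<close>. Left
  multiplication by \<open>h\<close> turns this operator \<open>T\<close> into \<open>\<Sum> L(S h\<^sub>2) \<circ> T \<circ> L(h\<^sub>1)\<close>, where \<open>L\<close> is left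
  multiplication, and cyclicity of the trace replaces it by \<open>\<Sum> T \<circ> L(h\<^sub>1 S h\<^sub>2) = \<epsilon>(h) T\<close>. For
  \<open>F = \<lambda>\<close> the operator is \<open>x \<mapsto> \<lambda>(x) 1\<close>, with trace \<open>\<lambda>(1) = 1\<close>.\<close>

lemma normalized_left_integral:
  assumes "finite_dimensional" and l: "biinvariant l" "l 1 = 1"
  obtains \<Lambda> where "left_integral \<Lambda>" "l \<Lambda> = 1"
proof -
  obtain B c where B: "finite B" "\<And>i. form1 (c i)"
    and expand: "\<And>F x. form1 F \<Longrightarrow> F x = (\<Sum>i\<in>B. c i x * F i)"
    using dual_basis[OF assms(1)] by blast
  note [multilinear] = form1_compose[OF B(2)]
  define \<Lambda> where "\<Lambda> = (\<Sum>i\<in>B. \<Sum>(a, b)\<leftarrow>\<Delta> i. c i (S (S b)) *s a)"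
  have \<Lambda>: "F \<Lambda> = (\<Sum>i\<in>B. \<Sum>(a, b)\<leftarrow>\<Delta> i. c i (S (S b)) * F a)" if "form1 F" for F
    unfolding \<Lambda>_def using that by (simp add: form1_of_sum form1_of_pair_sum) (simp add: form1_def)
  have "h * \<Lambda> = \<epsilon> h *s \<Lambda>" for h
  proof (rule eq_by_forms)
    fix F assume F: "form1 F"
    note [multilinear] = form1_compose[OF F]
    have shift: "(\<Sum>(a, b)\<leftarrow>\<Delta> x. c i (S (S b)) * F (h * a))
        = (\<Sum>(h1, h2)\<leftarrow>\<Delta> h. \<Sum>(a, b)\<leftarrow>\<Delta> (h1 * x). c i (S h2 * S (S b)) * F a)" for x i
    proof -
      have "(\<Sum>(h1, h2)\<leftarrow>\<Delta> h. \<Sum>(a, b)\<leftarrow>\<Delta> (h1 * x). c i (S h2 * S (S b)) * F a)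
          = (\<Sum>(h1, h2)\<leftarrow>\<Delta> h. \<Sum>(p, q)\<leftarrow>\<Delta> h1. \<Sum>(a, b)\<leftarrow>\<Delta> x. c i (S h2 * S (S (q * b))) * F (p * a))"
        by (intro pair_sum_cong comult_mult_form multilinear)
      also have "\<dots> = (\<Sum>(h1, h2)\<leftarrow>\<Delta> h. \<Sum>(p, q)\<leftarrow>\<Delta> h1. \<Sum>(a, b)\<leftarrow>\<Delta> x. c i (S (S q * h2) * S (S b)) * F (p * a))"
        by (simp only: S_mult mult.assoc)
      also have "\<dots> = (\<Sum>(h1, h2)\<leftarrow>\<Delta> h. \<Sum>(p, q)\<leftarrow>\<Delta> h2. \<Sum>(a, b)\<leftarrow>\<Delta> x. c i (S (S p * q) * S (S b)) * F (h1 * a))"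
        by (rule coassoc_form) (intro multilinear)
      also have "\<dots> = (\<Sum>(a, b)\<leftarrow>\<Delta> x. c i (S 1 * S (S b)) * F (h * a))"
        by (rule antipode_left_tail) (intro multilinear)
      finally show ?thesis by (simp add: S_one)
    qed
    have cyclic: "(\<Sum>i\<in>B. \<Sum>(a, b)\<leftarrow>\<Delta> (p * i). c i (q * S (S b)) * F a)
        = (\<Sum>j\<in>B. \<Sum>(a, b)\<leftarrow>\<Delta> (p * (q * j)). c j (S (S b)) * F a)" for p q
    proof -
      let ?K = "\<lambda>j z. \<Sum>(a, b)\<leftarrow>\<Delta> (p * z). c j (S (S b)) * F a"
      have "c i (q * S (S b)) * F a = (\<Sum>j\<in>B. c i (q * j) * (c j (S (S b)) * F a))" for i a b
        using expand[of "\<lambda>z. c i (q * z) * F a" "S (S b)"] by (simp add: mult_ac multilinear)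
      then have "(\<Sum>i\<in>B. \<Sum>(a, b)\<leftarrow>\<Delta> (p * i). c i (q * S (S b)) * F a)
          = (\<Sum>i\<in>B. \<Sum>j\<in>B. c i (q * j) * ?K j i)"
        by (simp only: pair_sum_sum_swap pair_sum_mult_left)
      also have "\<dots> = (\<Sum>j\<in>B. \<Sum>i\<in>B. c i (q * j) * ?K j i)"
        by (rule sum.swap)
      also have "\<dots> = (\<Sum>j\<in>B. ?K j (q * j))"
        by (intro sum.cong refl expand[symmetric] multilinear)
      finally show ?thesis .
    qed
    have "form1 (\<lambda>z. F (h * z))" by (intro multilinear)
    then have "F (h * \<Lambda>) = (\<Sum>i\<in>B. \<Sum>(a, b)\<leftarrow>\<Delta> i. c i (S (S b)) * F (h * a))"
      by (rule \<Lambda>)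
    also have "\<dots> = (\<Sum>(h1, h2)\<leftarrow>\<Delta> h. \<Sum>i\<in>B. \<Sum>(a, b)\<leftarrow>\<Delta> (h1 * i). c i (S h2 * S (S b)) * F a)"
      by (simp only: shift pair_sum_sum_swap)
    also have "\<dots> = (\<Sum>j\<in>B. \<Sum>(h1, h2)\<leftarrow>\<Delta> h. \<Sum>(a, b)\<leftarrow>\<Delta> (h1 * S h2 * j). c j (S (S b)) * F a)"
      by (simp only: cyclic pair_sum_sum_swap mult.assoc)
    also have "\<dots> = (\<Sum>j\<in>B. \<epsilon> h * (\<Sum>(a, b)\<leftarrow>\<Delta> (1 * j). c j (S (S b)) * F a))"
      by (intro sum.cong refl antipode_right_form[where F = "\<lambda>z. \<Sum>(a, b)\<leftarrow>\<Delta> (z * _). _ a b"] multilinear)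
    also have "\<dots> = \<epsilon> h * F \<Lambda>"
      by (simp add: \<Lambda>[OF F] sum_distrib_left)
    also have "\<dots> = F (\<epsilon> h *s \<Lambda>)"
      using F by (simp add: form1_def)
    finally show "F (h * \<Lambda>) = F (\<epsilon> h *s \<Lambda>)" .
  qed
  then have "left_integral \<Lambda>" by (simp add: left_integral_def)
  moreover have "l \<Lambda> = 1"
  proof -
    have l1: "form1 l" using l(1) by (rule biinvariant_form)
    have "l \<Lambda> = (\<Sum>i\<in>B. \<Sum>(a, b)\<leftarrow>\<Delta> i. l a * c i (S (S b)))"
      by (simp add: \<Lambda>[OF l1] mult.commute)
    also have "\<dots> = (\<Sum>i\<in>B. l i * c i (S (S 1)))"
      by (intro sum.cong refl biinvariant_right[OF l(1)] multilinear)
    also have "\<dots> = l 1"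
      by (simp add: S_one expand[OF l1, of 1] mult.commute)
    finally show ?thesis using l(2) by simp
  qed
  ultimately show ?thesis by (rule that)
qed

text \<open>For a two-sided integral \<open>\<Lambda>\<close> with \<open>\<lambda>(\<Lambda>) = 1\<close>, both \<open>\<Sum> \<Lambda>\<^sub>1 \<lambda>(a \<Lambda>\<^sub>2)\<close> and
  \<open>\<Sum> \<Lambda>\<^sub>1 \<lambda>(\<Lambda>\<^sub>2 S\<^sup>2(a))\<close> are equal to \<open>S(a)\<close>, and \<open>\<Sum> \<lambda>(S(z) \<Lambda>\<^sub>1) \<Lambda>\<^sub>2 = z\<close> recovers every element
  from \<open>\<Delta>(\<Lambda>)\<close>. This computes the Nakayama automorphism of \<open>\<lambda>\<close>.\<close>

lemma biinvariant_nakayama: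
  assumes l: "biinvariant l" and \<Lambda>: "left_integral \<Lambda>" "right_integral \<Lambda>" "l \<Lambda> = 1"
  shows "l (z * S (S a)) = l (a * z)"
proof -
  have l1: "form1 l" using l by (rule biinvariant_form)
  note [multilinear] = form1_compose[OF l1]
  have left_shift: "(\<Sum>(p, q)\<leftarrow>\<Delta> \<Lambda>. F p (a * q)) = (\<Sum>(p, q)\<leftarrow>\<Delta> \<Lambda>. F (S a * p) q)"
    if F: "form2 F" for F a
  proof -
    note [multilinear] = form2_compose[OF F]
    have scale: "(\<Sum>(u, v)\<leftarrow>\<Delta> (b * \<Lambda>). F (S c * u) v) = \<epsilon> b * (\<Sum>(u, v)\<leftarrow>\<Delta> \<Lambda>. F (S c * u) v)" for b c
      using \<Lambda>(1) comult_scale_form[of "\<lambda>u v. F (S c * u) v" "\<epsilon> b" \<Lambda>]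
      by (simp add: left_integral_def multilinear)
    have "(\<Sum>(p, q)\<leftarrow>\<Delta> \<Lambda>. F p (a * q)) = (\<Sum>(p, q)\<leftarrow>\<Delta> \<Lambda>. F (1 * p) (a * q))"
      by simp
    also have "\<dots> = (\<Sum>(c, d)\<leftarrow>\<Delta> a. \<Sum>(c1, c2)\<leftarrow>\<Delta> c. \<Sum>(p, q)\<leftarrow>\<Delta> \<Lambda>. F (S c1 * c2 * p) (d * q))"
      by (rule antipode_left_head[symmetric]) (intro multilinear)
    also have "\<dots> = (\<Sum>(c, d)\<leftarrow>\<Delta> a. \<Sum>(d1, d2)\<leftarrow>\<Delta> d. \<Sum>(p, q)\<leftarrow>\<Delta> \<Lambda>. F (S c * d1 * p) (d2 * q))"
      by (rule coassoc_form) (intro multilinear)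
    also have "\<dots> = (\<Sum>(c, d)\<leftarrow>\<Delta> a. \<Sum>(d1, d2)\<leftarrow>\<Delta> d. \<Sum>(p, q)\<leftarrow>\<Delta> \<Lambda>. F (S c * (d1 * p)) (d2 * q))"
      by (simp only: mult.assoc)
    also have "\<dots> = (\<Sum>(c, d)\<leftarrow>\<Delta> a. \<Sum>(u, v)\<leftarrow>\<Delta> (d * \<Lambda>). F (S c * u) v)"
      by (intro pair_sum_cong comult_mult_form[symmetric] multilinear)
    also have "\<dots> = (\<Sum>(p, q)\<leftarrow>\<Delta> \<Lambda>. F (S a * p) q)"
      unfolding scale by (intro counit_right_form multilinear)
    finally show ?thesis .
  qed
  have right_shift: "(\<Sum>(p, q)\<leftarrow>\<Delta> \<Lambda>. F (p * a) q) = (\<Sum>(p, q)\<leftarrow>\<Delta> \<Lambda>. F p (q * S a))"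
    if F: "form2 F" for F a
  proof -
    note [multilinear] = form2_compose[OF F]
    have scale: "(\<Sum>(u, v)\<leftarrow>\<Delta> (\<Lambda> * b). F u (v * S c)) = \<epsilon> b * (\<Sum>(u, v)\<leftarrow>\<Delta> \<Lambda>. F u (v * S c))" for b c
      using \<Lambda>(2) comult_scale_form[of "\<lambda>u v. F u (v * S c)" "\<epsilon> b" \<Lambda>]
      by (simp add: right_integral_def multilinear)
    have "(\<Sum>(p, q)\<leftarrow>\<Delta> \<Lambda>. F (p * a) q) = (\<Sum>(p, q)\<leftarrow>\<Delta> \<Lambda>. F (p * a) (q * 1))"
      by simp
    also have "\<dots> = (\<Sum>(c, d)\<leftarrow>\<Delta> a. \<Sum>(d1, d2)\<leftarrow>\<Delta> d. \<Sum>(p, q)\<leftarrow>\<Delta> \<Lambda>. F (p * c) (q * (d1 * S d2)))"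
      by (rule antipode_right_tail[symmetric]) (intro multilinear)
    also have "\<dots> = (\<Sum>(c, d)\<leftarrow>\<Delta> a. \<Sum>(c1, c2)\<leftarrow>\<Delta> c. \<Sum>(p, q)\<leftarrow>\<Delta> \<Lambda>. F (p * c1) (q * (c2 * S d)))"
      by (rule coassoc_form[symmetric]) (intro multilinear)
    also have "\<dots> = (\<Sum>(c, d)\<leftarrow>\<Delta> a. \<Sum>(p, q)\<leftarrow>\<Delta> \<Lambda>. \<Sum>(c1, c2)\<leftarrow>\<Delta> c. F (p * c1) (q * c2 * S d))"
      unfolding mult.assoc by (intro pair_sum_cong pair_sum_swap)
    also have "\<dots> = (\<Sum>(c, d)\<leftarrow>\<Delta> a. \<Sum>(u, v)\<leftarrow>\<Delta> (\<Lambda> * c). F u (v * S d))"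
      by (intro pair_sum_cong comult_mult_form[symmetric] multilinear)
    also have "\<dots> = (\<Sum>(p, q)\<leftarrow>\<Delta> \<Lambda>. F p (q * S a))"
      unfolding scale by (intro counit_left_form multilinear)
    finally show ?thesis .
  qed
  have S1: "(\<Sum>(p, q)\<leftarrow>\<Delta> \<Lambda>. F p * l (a * q)) = F (S a)" if F: "form1 F" for F
  proof -
    note [multilinear] = form1_compose[OF F]
    have "(\<Sum>(p, q)\<leftarrow>\<Delta> \<Lambda>. F p * l (a * q)) = (\<Sum>(p, q)\<leftarrow>\<Delta> \<Lambda>. F (S a * p) * l q)"
      by (rule left_shift) (intro multilinear)
    also have "\<dots> = F (S a * 1) * l \<Lambda>"
      by (rule biinvariant_left[OF l]) (intro multilinear)
    finally show ?thesis by (simp add: \<Lambda>(3))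
  qed
  have S2: "(\<Sum>(p, q)\<leftarrow>\<Delta> \<Lambda>. F p * l (q * S (S a))) = F (S a)" if F: "form1 F" for F
  proof -
    note [multilinear] = form1_compose[OF F]
    have "(\<Sum>(p, q)\<leftarrow>\<Delta> \<Lambda>. F p * l (q * S (S a))) = (\<Sum>(p, q)\<leftarrow>\<Delta> \<Lambda>. F (p * S a) * l q)"
      by (rule right_shift[symmetric]) (intro multilinear)
    also have "\<dots> = F (1 * S a) * l \<Lambda>"
      by (rule biinvariant_left[OF l]) (intro multilinear)
    finally show ?thesis by (simp add: \<Lambda>(3))
  qed
  have recover: "(\<Sum>(p, q)\<leftarrow>\<Delta> \<Lambda>. l (S z * p) * \<phi> q) = \<phi> z" if \<phi>: "form1 \<phi>" for \<phi>
  proof -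
    note [multilinear] = form1_compose[OF \<phi>]
    have "(\<Sum>(p, q)\<leftarrow>\<Delta> \<Lambda>. l (S z * p) * \<phi> q) = (\<Sum>(p, q)\<leftarrow>\<Delta> \<Lambda>. l p * \<phi> (z * q))"
      by (rule left_shift[symmetric]) (intro multilinear)
    also have "\<dots> = l \<Lambda> * \<phi> (z * 1)"
      by (rule biinvariant_right[OF l]) (intro multilinear)
    finally show ?thesis by (simp add: \<Lambda>(3))
  qed
  have "l (z * S (S a)) = (\<Sum>(p, q)\<leftarrow>\<Delta> \<Lambda>. l (S z * p) * l (q * S (S a)))"
    by (rule recover[symmetric]) (intro multilinear)
  also have "\<dots> = l (S z * S a)"
    by (rule S2) (intro multilinear)
  also have "\<dots> = (\<Sum>(p, q)\<leftarrow>\<Delta> \<Lambda>. l (S z * p) * l (a * q))"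
    by (rule S1[symmetric]) (intro multilinear)
  also have "\<dots> = l (a * z)"
    by (rule recover) (intro multilinear)
  finally show ?thesis .
qed

end

section \<open>The universal R-matrix\<close>

context quasitriangular_hopf_algebra
begin

lemma R_intertwines_form:
  assumes "form2 F"
  shows "(\<Sum>(r1, r2)\<leftarrow>R. \<Sum>(h1, h2)\<leftarrow>\<Delta> h. F (r1 * h1) (r2 * h2))
       = (\<Sum>(r1, r2)\<leftarrow>R. \<Sum>(h1, h2)\<leftarrow>\<Delta> h. F (h2 * r1) (h1 * r2))"
proof -
  have "pair_words [(r1 * h1, r2 * h2). (r1, r2) \<leftarrow> R, (h1, h2) \<leftarrow> \<Delta> h]
      = [[r1 * h1, r2 * h2]. (r1, r2) \<leftarrow> R, (h1, h2) \<leftarrow> \<Delta> h]"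
    "pair_words [(h2 * r1, h1 * r2). (r1, r2) \<leftarrow> R, (h1, h2) \<leftarrow> \<Delta> h]
      = [[h2 * r1, h1 * r2]. (r1, r2) \<leftarrow> R, (h1, h2) \<leftarrow> \<Delta> h]"
    by (simp_all add: pair_words_def map_concat case_prod_unfold o_def)
  with tensor_eq_form2[OF _ assms, of "[(r1 * h1, r2 * h2). (r1, r2) \<leftarrow> R, (h1, h2) \<leftarrow> \<Delta> h]"
      "[(h2 * r1, h1 * r2). (r1, r2) \<leftarrow> R, (h1, h2) \<leftarrow> \<Delta> h]"] R_intertwines[of h]
  show ?thesis
    by (simp add: sum_list_concat_pairs case_prod_unfold o_def)
qed

lemma R_comult_left_form:
  assumes "form3 F"
  shows "(\<Sum>(r1, r2)\<leftarrow>R. \<Sum>(a, b)\<leftarrow>\<Delta> r1. F a b r2) = (\<Sum>(r1, r2)\<leftarrow>R. \<Sum>(q1, q2)\<leftarrow>R. F r1 q1 (r2 * q2))"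
proof -
  note * = tensor_eq_form3[OF R_comult_left assms refl]
  show ?thesis
    using * by (simp add: sum_list_concat_pairs case_prod_unfold o_def)
qed

lemma R_comult_right_form:
  assumes "form3 F"
  shows "(\<Sum>(r1, r2)\<leftarrow>R. \<Sum>(a, b)\<leftarrow>\<Delta> r2. F r1 a b) = (\<Sum>(r1, r2)\<leftarrow>R. \<Sum>(q1, q2)\<leftarrow>R. F (r1 * q1) q2 r2)"
proof -
  note * = tensor_eq_form3[OF R_comult_right assms refl]
  show ?thesis
    using * by (simp add: sum_list_concat_pairs case_prod_unfold o_def)
qed

text \<open>Applying the counit to the outer leg of \<open>(\<Delta> \<otimes> id)(R) = R\<^sup>1\<^sup>3 R\<^sup>2\<^sup>3\<close> gives
  \<open>R = (1 \<otimes> t) R\<close> with \<open>t = \<Sum> \<epsilon>(R\<^sup>1) R\<^sup>2\<close>, and \<open>R\<close> can be cancelled; likewise on the other side.\<close>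

lemma R_counit:
  assumes F: "form1 F"
  shows R_counit_left: "(\<Sum>(r1, r2)\<leftarrow>R. \<epsilon> r1 * F r2) = F 1"
    and R_counit_right: "(\<Sum>(r1, r2)\<leftarrow>R. \<epsilon> r2 * F r1) = F 1"
proof -
  note [multilinear] = form1_compose[OF F]
  obtain R' where R': "tensor_eq scale UNIV (pair_words (tensor_mult (*) R R')) [[1, 1]]"
    using R_invertible by blast
  have inv: "(\<Sum>(r1, r2)\<leftarrow>R. \<Sum>(s1, s2)\<leftarrow>R'. G (r1 * s1) (r2 * s2)) = G 1 1" if "form2 G" for G
    using tensor_eq_form2[OF _ that, of "tensor_mult (*) R R'" "[(1, 1)]"] R'
    by (simp add: pair_words_def tensor_mult_def sum_list_concat_pairs case_prod_unfold o_def)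
  have left: "(\<Sum>(r1, r2)\<leftarrow>R. G r1 r2) = (\<Sum>(r1, r2)\<leftarrow>R. \<Sum>(q1, q2)\<leftarrow>R. \<epsilon> r1 * G q1 (r2 * q2))"
    if G: "form2 G" for G
  proof -
    note [multilinear] = form2_compose[OF G]
    have "(\<Sum>(r1, r2)\<leftarrow>R. G r1 r2) = (\<Sum>(r1, r2)\<leftarrow>R. \<Sum>(a, b)\<leftarrow>\<Delta> r1. \<epsilon> a * G b r2)"
      by (intro pair_sum_cong counit_left_form[symmetric] multilinear)
    also have "\<dots> = (\<Sum>(r1, r2)\<leftarrow>R. \<Sum>(q1, q2)\<leftarrow>R. \<epsilon> r1 * G q1 (r2 * q2))"
      by (intro R_comult_left_form multilinear)
    finally show ?thesis .
  qed
  have right: "(\<Sum>(r1, r2)\<leftarrow>R. G r1 r2) = (\<Sum>(r1, r2)\<leftarrow>R. \<Sum>(q1, q2)\<leftarrow>R. \<epsilon> r2 * G (r1 * q1) q2)"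
    if G: "form2 G" for G
  proof -
    note [multilinear] = form2_compose[OF G]
    have "(\<Sum>(r1, r2)\<leftarrow>R. G r1 r2) = (\<Sum>(r1, r2)\<leftarrow>R. \<Sum>(a, b)\<leftarrow>\<Delta> r2. \<epsilon> b * G r1 a)"
      by (intro pair_sum_cong counit_right_form[symmetric] multilinear)
    also have "\<dots> = (\<Sum>(r1, r2)\<leftarrow>R. \<Sum>(q1, q2)\<leftarrow>R. \<epsilon> r2 * G (r1 * q1) q2)"
      by (intro R_comult_right_form multilinear)
    finally show ?thesis .
  qed
  have "F 1 = (\<Sum>(q1, q2)\<leftarrow>R. \<Sum>(s1, s2)\<leftarrow>R'. \<epsilon> (q1 * s1) * F (q2 * s2))"
    using inv[of "\<lambda>a b. \<epsilon> a * F b"] by (simp add: counit_one multilinear)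
  also have "\<dots> = (\<Sum>(r1, r2)\<leftarrow>R. \<Sum>(q1, q2)\<leftarrow>R. \<epsilon> r1 * (\<Sum>(s1, s2)\<leftarrow>R'. \<epsilon> (q1 * s1) * F (r2 * q2 * s2)))"
    by (intro left multilinear)
  also have "\<dots> = (\<Sum>(r1, r2)\<leftarrow>R. \<epsilon> r1 * F r2)"
    using inv[of "\<lambda>a b. \<epsilon> a * F (_ * b)"]
    by (simp add: counit_one pair_sum_mult_left mult.assoc multilinear)
  finally show "(\<Sum>(r1, r2)\<leftarrow>R. \<epsilon> r1 * F r2) = F 1" by simp
  have "F 1 = (\<Sum>(q1, q2)\<leftarrow>R. \<Sum>(s1, s2)\<leftarrow>R'. \<epsilon> (q2 * s2) * F (q1 * s1))"
    using inv[of "\<lambda>a b. \<epsilon> b * F a"] by (simp add: counit_one multilinear)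
  also have "\<dots> = (\<Sum>(r1, r2)\<leftarrow>R. \<Sum>(q1, q2)\<leftarrow>R. \<epsilon> r2 * (\<Sum>(s1, s2)\<leftarrow>R'. \<epsilon> (q2 * s2) * F (r1 * q1 * s1)))"
    by (intro right multilinear)
  also have "\<dots> = (\<Sum>(r1, r2)\<leftarrow>R. \<epsilon> r2 * F r1)"
    using inv[of "\<lambda>a b. \<epsilon> b * F (_ * a)"]
    by (simp add: counit_one pair_sum_mult_left mult.assoc multilinear)
  finally show "(\<Sum>(r1, r2)\<leftarrow>R. \<epsilon> r2 * F r1) = F 1" by simp
qed

text \<open>Both cancellations are \<open>(id \<otimes> \<Delta>)(R) = R\<^sup>1\<^sup>3 R\<^sup>1\<^sup>2\<close> followed by an antipode axiom in the second
  and third leg.\<close>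

lemma R_antipode_left:
  assumes F: "form2 F"
  shows "(\<Sum>(r1, r2)\<leftarrow>R. \<Sum>(q1, q2)\<leftarrow>R. F (r1 * q1) (S q2 * r2)) = F 1 1"
proof -
  note [multilinear] = form2_compose[OF F]
  have "(\<Sum>(r1, r2)\<leftarrow>R. \<Sum>(q1, q2)\<leftarrow>R. F (r1 * q1) (S q2 * r2)) = (\<Sum>(r1, r2)\<leftarrow>R. \<Sum>(a, b)\<leftarrow>\<Delta> r2. F r1 (S a * b))"
    by (rule R_comult_right_form[symmetric]) (intro multilinear)
  also have "\<dots> = (\<Sum>(r1, r2)\<leftarrow>R. \<epsilon> r2 * F r1 1)"
    by (intro pair_sum_cong antipode_left_form[of "F _"] multilinear)
  also have "\<dots> = F 1 1"
    by (intro R_counit_right multilinear)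
  finally show ?thesis .
qed

lemma R_antipode_right:
  assumes F: "form2 F"
  shows "(\<Sum>(r1, r2)\<leftarrow>R. \<Sum>(q1, q2)\<leftarrow>R. F (r1 * q1) (q2 * S r2)) = F 1 1"
proof -
  note [multilinear] = form2_compose[OF F]
  have "(\<Sum>(r1, r2)\<leftarrow>R. \<Sum>(q1, q2)\<leftarrow>R. F (r1 * q1) (q2 * S r2)) = (\<Sum>(r1, r2)\<leftarrow>R. \<Sum>(a, b)\<leftarrow>\<Delta> r2. F r1 (a * S b))"
    by (rule R_comult_right_form[symmetric]) (intro multilinear)
  also have "\<dots> = (\<Sum>(r1, r2)\<leftarrow>R. \<epsilon> r2 * F r1 1)"
    by (intro pair_sum_cong antipode_right_form[of "F _"] multilinear)
  also have "\<dots> = F 1 1"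
    by (intro R_counit_right multilinear)
  finally show ?thesis .
qed

text \<open>This is \<open>\<Sum> R\<^sup>1 h\<^sub>2 \<otimes> R\<^sup>2 h\<^sub>3 = \<Sum> h\<^sub>3 R\<^sup>1 \<otimes> h\<^sub>2 R\<^sup>2\<close>, multiplied in the second leg by \<open>S(h\<^sub>1)\<close> from the
  left and by \<open>S(h\<^sub>4)\<close> from the right.\<close>

lemma R_intertwines_antipode:
  assumes F: "form2 F"
  shows "(\<Sum>(a, b)\<leftarrow>\<Delta> h. \<Sum>(r1, r2)\<leftarrow>R. F (r1 * b) (S a * r2))
       = (\<Sum>(a, b)\<leftarrow>\<Delta> h. \<Sum>(r1, r2)\<leftarrow>R. F (a * r1) (r2 * S b))"
proof -
  note [multilinear] = form2_compose[OF F]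
  have "(\<Sum>(a, b)\<leftarrow>\<Delta> h. \<Sum>(r1, r2)\<leftarrow>R. F (r1 * b) (S a * r2))
      = (\<Sum>(a, b)\<leftarrow>\<Delta> h. \<Sum>(c, d)\<leftarrow>\<Delta> b. \<Sum>(p, q)\<leftarrow>\<Delta> d. \<Sum>(r1, r2)\<leftarrow>R. F (r1 * c) (S a * r2 * (p * S q)))"
    using antipode_right_tail[of "\<lambda>c z. \<Sum>(r1, r2)\<leftarrow>R. F (r1 * c) (S _ * r2 * z)"]
    by (simp add: multilinear)
  also have "\<dots> = (\<Sum>(a, b)\<leftarrow>\<Delta> h. \<Sum>(c, d)\<leftarrow>\<Delta> b. \<Sum>(p, q)\<leftarrow>\<Delta> c. \<Sum>(r1, r2)\<leftarrow>R. F (r1 * p) (S a * r2 * (q * S d)))"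
    by (intro pair_sum_cong coassoc_form[symmetric] multilinear)
  also have "\<dots> = (\<Sum>(a, b)\<leftarrow>\<Delta> h. \<Sum>(c, d)\<leftarrow>\<Delta> b. \<Sum>(r1, r2)\<leftarrow>R. \<Sum>(p, q)\<leftarrow>\<Delta> c. F (r1 * p) (S a * (r2 * q) * S d))"
    unfolding mult.assoc by (intro pair_sum_cong pair_sum_swap)
  also have "\<dots> = (\<Sum>(a, b)\<leftarrow>\<Delta> h. \<Sum>(c, d)\<leftarrow>\<Delta> b. \<Sum>(r1, r2)\<leftarrow>R. \<Sum>(p, q)\<leftarrow>\<Delta> c. F (q * r1) (S a * (p * r2) * S d))"
    by (intro pair_sum_cong R_intertwines_form[of "\<lambda>u v. F u (S _ * v * S _)"] multilinear)
  also have "\<dots> = (\<Sum>(a, b)\<leftarrow>\<Delta> h. \<Sum>(c, d)\<leftarrow>\<Delta> b. \<Sum>(p, q)\<leftarrow>\<Delta> c. \<Sum>(r1, r2)\<leftarrow>R. F (q * r1) (S a * p * r2 * S d))"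
    unfolding mult.assoc by (intro pair_sum_cong pair_sum_swap)
  also have "\<dots> = (\<Sum>(a, b)\<leftarrow>\<Delta> h. \<Sum>(p, e)\<leftarrow>\<Delta> b. \<Sum>(q, d)\<leftarrow>\<Delta> e. \<Sum>(r1, r2)\<leftarrow>R. F (q * r1) (S a * p * r2 * S d))"
    by (intro pair_sum_cong coassoc_form multilinear)
  also have "\<dots> = (\<Sum>(a, b)\<leftarrow>\<Delta> h. \<Sum>(p, q)\<leftarrow>\<Delta> a. \<Sum>(c, d)\<leftarrow>\<Delta> b. \<Sum>(r1, r2)\<leftarrow>R. F (c * r1) (S p * q * r2 * S d))"
    by (rule coassoc_form[symmetric]) (intro multilinear)
  also have "\<dots> = (\<Sum>(c, d)\<leftarrow>\<Delta> h. \<Sum>(r1, r2)\<leftarrow>R. F (c * r1) (1 * r2 * S d))"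
    by (rule antipode_left_head) (intro multilinear)
  finally show ?thesis by simp
qed


section \<open>The transmuted coalgebra\<close>

lemma comult_R_sum:
  "(\<Sum>(a, b)\<leftarrow>comult_R h. F a b)
    = (\<Sum>(r1, r2)\<leftarrow>R. \<Sum>(h1, h2)\<leftarrow>\<Delta> h. F (h1 * S r2) (adj r1 h2) :: 'c::comm_monoid_add)"
  by (simp add: comult_R_def sum_list_concat_pairs case_prod_unfold o_def)

lemma form1_comult_R [multilinear]:
  assumes F: "form2 F" and g: "endo g"
  shows "form1 (\<lambda>x. \<Sum>(a, b)\<leftarrow>comult_R (g x). F a b)"
proof -
  note [multilinear] = form2_compose[OF F]
  show ?thesis unfolding comult_R_sum using g by (intro multilinear)
qed

text \<open>\<open>\<Delta>\<^sub>R\<close> is a morphism of \<open>H\<close>-modules for the adjoint action, because \<open>R\<close> intertwines \<open>\<Delta>\<close> with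
  its opposite.\<close>

lemma comult_R_adj:
  assumes F: "form2 F"
  shows "(\<Sum>(a, b)\<leftarrow>comult_R (adj h x). F a b)
       = (\<Sum>(h1, h2)\<leftarrow>\<Delta> h. \<Sum>(a, b)\<leftarrow>comult_R x. F (adj h1 a) (adj h2 b))"
proof -
  note [multilinear] = form2_compose[OF F]
  have "(\<Sum>(a, b)\<leftarrow>comult_R (adj h x). F a b)
      = (\<Sum>(r1, r2)\<leftarrow>R. \<Sum>(a, b)\<leftarrow>\<Delta> h. \<Sum>(c, d)\<leftarrow>\<Delta> b. \<Sum>(u, v)\<leftarrow>\<Delta> x. F (a * u * S d * S r2) (adj r1 (adj c v)))"
    unfolding comult_R_sum by (intro pair_sum_cong comult_adj_form multilinear)
  also have "\<dots> = (\<Sum>(a, b)\<leftarrow>\<Delta> h. \<Sum>(r1, r2)\<leftarrow>R. \<Sum>(c, d)\<leftarrow>\<Delta> b. \<Sum>(u, v)\<leftarrow>\<Delta> x. F (a * u * S (r2 * d)) (adj (r1 * c) v))"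
    unfolding S_mult adj_mult mult.assoc by (rule pair_sum_swap)
  also have "\<dots> = (\<Sum>(a, b)\<leftarrow>\<Delta> h. \<Sum>(r1, r2)\<leftarrow>R. \<Sum>(c, d)\<leftarrow>\<Delta> b. \<Sum>(u, v)\<leftarrow>\<Delta> x. F (a * u * S (c * r2)) (adj (d * r1) v))"
    by (intro pair_sum_cong R_intertwines_form multilinear)
  also have "\<dots> = (\<Sum>(a, b)\<leftarrow>\<Delta> h. \<Sum>(c, d)\<leftarrow>\<Delta> b. \<Sum>(r1, r2)\<leftarrow>R. \<Sum>(u, v)\<leftarrow>\<Delta> x. F (a * u * S (c * r2)) (adj (d * r1) v))"
    by (intro pair_sum_cong pair_sum_swap)
  also have "\<dots> = (\<Sum>(a, b)\<leftarrow>\<Delta> h. \<Sum>(c, d)\<leftarrow>\<Delta> b. \<Sum>(u, v)\<leftarrow>comult_R x. F (a * u * S c) (adj d v))"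
    by (simp only: comult_R_sum S_mult adj_mult mult.assoc)
  also have "\<dots> = (\<Sum>(b, d)\<leftarrow>\<Delta> h. \<Sum>(a, c)\<leftarrow>\<Delta> b. \<Sum>(u, v)\<leftarrow>comult_R x. F (a * u * S c) (adj d v))"
    by (rule coassoc_form[symmetric]) (intro multilinear)
  also have "\<dots> = (\<Sum>(b, d)\<leftarrow>\<Delta> h. \<Sum>(u, v)\<leftarrow>comult_R x. \<Sum>(a, c)\<leftarrow>\<Delta> b. F (a * u * S c) (adj d v))"
    by (intro pair_sum_cong pair_sum_swap)
  also have "\<dots> = (\<Sum>(b, d)\<leftarrow>\<Delta> h. \<Sum>(u, v)\<leftarrow>comult_R x. F (adj b u) (adj d v))"
    by (intro pair_sum_cong adj_form[of "\<lambda>z. F z _", symmetric] multilinear)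
  finally show ?thesis .
qed

text \<open>Both sides reduce to
  \<open>\<Sum> h\<^sub>1 S(P\<^sup>2) S(R\<^sup>2) \<otimes> R\<^sup>1 \<cdot> (h\<^sub>2 S(Q\<^sup>2)) \<otimes> (P\<^sup>1 Q\<^sup>1) \<cdot> h\<^sub>3\<close> with three copies \<open>P\<close>, \<open>Q\<close>, \<open>R\<close> of the R-matrix. The left
  side produces two of them from \<open>(id \<otimes> \<Delta>)(R)\<close>, the right side, by equivariance of \<open>\<Delta>\<^sub>R\<close>, from
  \<open>(\<Delta> \<otimes> id)(R)\<close>.\<close>

lemma comult_R_coassoc:
  assumes F: "form3 F"
  shows "(\<Sum>(a, b)\<leftarrow>comult_R h. \<Sum>(c, d)\<leftarrow>comult_R a. F c d b)
       = (\<Sum>(a, b)\<leftarrow>comult_R h. \<Sum>(c, d)\<leftarrow>comult_R b. F a c d)"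
proof -
  note [multilinear] = form3_compose[OF F]
  let ?G = "\<lambda>a b c. \<Sum>(r1, r2)\<leftarrow>R. \<Sum>(p1, p2)\<leftarrow>R. \<Sum>(q1, q2)\<leftarrow>R.
    F (a * S p2 * S r2) (adj r1 (b * S q2)) (adj (p1 * q1) c)"
  have "(\<Sum>(a, b)\<leftarrow>comult_R h. \<Sum>(c, d)\<leftarrow>comult_R a. F c d b)
      = (\<Sum>(p1, p2)\<leftarrow>R. \<Sum>(h1, h2)\<leftarrow>\<Delta> h. \<Sum>(r1, r2)\<leftarrow>R. \<Sum>(u, v)\<leftarrow>\<Delta> (h1 * S p2). F (u * S r2) (adj r1 v) (adj p1 h2))"
    by (simp only: comult_R_sum)
  also have "\<dots> = (\<Sum>(p1, p2)\<leftarrow>R. \<Sum>(h1, h2)\<leftarrow>\<Delta> h. \<Sum>(r1, r2)\<leftarrow>R. \<Sum>(a, b)\<leftarrow>\<Delta> h1. \<Sum>(c, d)\<leftarrow>\<Delta> p2.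
      F (a * S d * S r2) (adj r1 (b * S c)) (adj p1 h2))"
  proof (intro pair_sum_cong, goal_cases)
    case (1 p1 p2 h1 h2 r1 r2)
    have "(\<Sum>(u, v)\<leftarrow>\<Delta> (h1 * S p2). F (u * S r2) (adj r1 v) (adj p1 h2))
        = (\<Sum>(a, b)\<leftarrow>\<Delta> h1. \<Sum>(c, d)\<leftarrow>\<Delta> (S p2). F (a * c * S r2) (adj r1 (b * d)) (adj p1 h2))"
      by (intro comult_mult_form multilinear)
    also have "\<dots> = (\<Sum>(a, b)\<leftarrow>\<Delta> h1. \<Sum>(c, d)\<leftarrow>\<Delta> p2. F (a * S d * S r2) (adj r1 (b * S c)) (adj p1 h2))"
      by (intro pair_sum_cong comult_S_form multilinear)
    finally show ?case .
  qed
  also have "\<dots> = (\<Sum>(h1, h2)\<leftarrow>\<Delta> h. \<Sum>(a, b)\<leftarrow>\<Delta> h1. \<Sum>(r1, r2)\<leftarrow>R. \<Sum>(p1, p2)\<leftarrow>R. \<Sum>(c, d)\<leftarrow>\<Delta> p2.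
      F (a * S d * S r2) (adj r1 (b * S c)) (adj p1 h2))"
  proof -
    have swap: "(\<Sum>(p1, p2)\<leftarrow>R. \<Sum>(r1, r2)\<leftarrow>R. \<Sum>(a, b)\<leftarrow>ts. K p1 p2 r1 r2 a b)
        = (\<Sum>(a, b)\<leftarrow>ts. \<Sum>(r1, r2)\<leftarrow>R. \<Sum>(p1, p2)\<leftarrow>R. K p1 p2 r1 r2 a b :: 'k)" for ts K
      by (rule trans[OF pair_sum_swap], rule trans[OF pair_sum_cong[OF pair_sum_swap]], rule pair_sum_swap)
    show ?thesis
      by (rule trans[OF pair_sum_swap], rule pair_sum_cong, rule swap)
  qed
  also have "\<dots> = (\<Sum>(h1, h2)\<leftarrow>\<Delta> h. \<Sum>(a, b)\<leftarrow>\<Delta> h1. ?G a b h2)"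
    by (intro pair_sum_cong R_comult_right_form multilinear)
  also have "\<dots> = (\<Sum>(h1, h2)\<leftarrow>\<Delta> h. \<Sum>(a, b)\<leftarrow>\<Delta> h2. ?G h1 a b)"
    by (rule coassoc_form) (intro multilinear)
  also have "\<dots> = (\<Sum>(h1, h2)\<leftarrow>\<Delta> h. \<Sum>(r1, r2)\<leftarrow>R. \<Sum>(p1, p2)\<leftarrow>R. \<Sum>(u, v)\<leftarrow>comult_R h2.
      F (h1 * S (r2 * p2)) (adj r1 u) (adj p1 v))"
    unfolding comult_R_sum S_mult adj_mult mult.assoc
    by (rule pair_sum_cong, rule trans[OF pair_sum_swap], rule pair_sum_cong,
        rule trans[OF pair_sum_swap], rule pair_sum_cong, rule pair_sum_swap)
  also have "\<dots> = (\<Sum>(h1, h2)\<leftarrow>\<Delta> h. \<Sum>(r1, r2)\<leftarrow>R. \<Sum>(c, d)\<leftarrow>\<Delta> r1. \<Sum>(u, v)\<leftarrow>comult_R h2.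
      F (h1 * S r2) (adj c u) (adj d v))"
    by (intro pair_sum_cong R_comult_left_form[symmetric] multilinear)
  also have "\<dots> = (\<Sum>(h1, h2)\<leftarrow>\<Delta> h. \<Sum>(r1, r2)\<leftarrow>R. \<Sum>(u, v)\<leftarrow>comult_R (adj r1 h2). F (h1 * S r2) u v)"
    by (intro pair_sum_cong comult_R_adj[symmetric] multilinear)
  also have "\<dots> = (\<Sum>(a, b)\<leftarrow>comult_R h. \<Sum>(c, d)\<leftarrow>comult_R b. F a c d)"
    unfolding comult_R_sum[of _ h] by (rule pair_sum_swap)
  finally show ?thesis .
qed

end

section \<open>The separable idempotent as a bilinear form\<close>

context quasitriangular_hopf_algebra
begin

lemma comult_R_counit_left:
  assumes F: "form1 F"
  shows "(\<Sum>(a, b)\<leftarrow>comult_R h. \<epsilon> a * F b) = F h"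
proof -
  note [multilinear] = form1_compose[OF F]
  have "(\<Sum>(a, b)\<leftarrow>comult_R h. \<epsilon> a * F b)
      = (\<Sum>(r1, r2)\<leftarrow>R. \<Sum>(h1, h2)\<leftarrow>\<Delta> h. \<epsilon> h1 * (\<epsilon> r2 * F (adj r1 h2)))"
    by (simp only: comult_R_sum counit_mult counit_S mult.assoc)
  also have "\<dots> = (\<Sum>(r1, r2)\<leftarrow>R. \<epsilon> r2 * F (adj r1 h))"
    by (intro pair_sum_cong counit_left_form multilinear)
  also have "\<dots> = F (adj 1 h)"
    by (intro R_counit_right multilinear)
  finally show ?thesis by (simp add: adj_one)
qed

lemma comult_R_counit_right:
  assumes F: "form1 F"
  shows "(\<Sum>(a, b)\<leftarrow>comult_R h. F a * \<epsilon> b) = F h"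
proof -
  note [multilinear] = form1_compose[OF F]
  have "(\<Sum>(a, b)\<leftarrow>comult_R h. F a * \<epsilon> b)
      = (\<Sum>(r1, r2)\<leftarrow>R. \<Sum>(h1, h2)\<leftarrow>\<Delta> h. \<epsilon> h2 * (\<epsilon> r1 * F (h1 * S r2)))"
    by (simp only: comult_R_sum counit_adj mult_ac)
  also have "\<dots> = (\<Sum>(r1, r2)\<leftarrow>R. \<epsilon> r1 * F (h * S r2))"
    by (intro pair_sum_cong counit_right_form multilinear)
  also have "\<dots> = F (h * S 1)"
    by (intro R_counit_left multilinear)
  finally show ?thesis by (simp add: S_one)
qed

text \<open>The transmutation is undone by a second copy of \<open>R\<close>, because
  \<open>\<Sum> R\<^sup>1 Q\<^sup>1 \<otimes> S(Q\<^sup>2) R\<^sup>2 = 1 \<otimes> 1\<close>.\<close>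

lemma comult_from_comult_R:
  assumes F: "form2 F"
  shows "(\<Sum>(a, b)\<leftarrow>comult_R c. \<Sum>(p1, p2)\<leftarrow>R. F (a * p2) (adj p1 b)) = (\<Sum>(a, b)\<leftarrow>\<Delta> c. F a b)"
proof -
  note [multilinear] = form2_compose[OF F]
  have "(\<Sum>(a, b)\<leftarrow>comult_R c. \<Sum>(p1, p2)\<leftarrow>R. F (a * p2) (adj p1 b))
      = (\<Sum>(q1, q2)\<leftarrow>R. \<Sum>(a, b)\<leftarrow>\<Delta> c. \<Sum>(p1, p2)\<leftarrow>R. F (a * (S q2 * p2)) (adj (p1 * q1) b))"
    by (simp only: comult_R_sum mult.assoc adj_mult)
  also have "\<dots> = (\<Sum>(a, b)\<leftarrow>\<Delta> c. \<Sum>(p1, p2)\<leftarrow>R. \<Sum>(q1, q2)\<leftarrow>R. F (a * (S q2 * p2)) (adj (p1 * q1) b))"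
    by (rule trans[OF pair_sum_swap], rule pair_sum_cong, rule pair_sum_swap)
  also have "\<dots> = (\<Sum>(a, b)\<leftarrow>\<Delta> c. F (a * 1) (adj 1 b))"
    by (intro pair_sum_cong R_antipode_left[of "\<lambda>u v. F (_ * v) (adj u _)"] multilinear)
  finally show ?thesis by (simp add: adj_one)
qed

text \<open>The bilinear form represented by \<open>e\<^sub>R\<close>, in which the coproduct of \<open>\<lambda>\<close> has been evaluated; see
  \<open>e_R_form\<close>.\<close>

definition e_form :: "('h \<Rightarrow> 'k) \<Rightarrow> 'h \<Rightarrow> 'h \<Rightarrow> 'k" where
  "e_form l x y = (\<Sum>(r1, r2)\<leftarrow>R. l (x * r2 * S (adj r1 y)))"

lemma form2_e_form:
  assumes "form1 l"
  shows "form2 (e_form l)"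
proof -
  note [multilinear] = form1_compose[OF assms]
  show ?thesis unfolding e_form_def by (intro multilinear)
qed

lemma e_form_mult:
  assumes "form1 l"
  shows "(\<Sum>(a, b)\<leftarrow>comult_R x. e_form l a b) = \<epsilon> x * l 1"
proof -
  note [multilinear] = form1_compose[OF assms]
  have "(\<Sum>(a, b)\<leftarrow>comult_R x. e_form l a b)
      = (\<Sum>(p1, p2)\<leftarrow>R. \<Sum>(a, b)\<leftarrow>\<Delta> x. \<Sum>(r1, r2)\<leftarrow>R. l (a * (S p2 * r2) * S (adj (r1 * p1) b)))"
    by (simp only: comult_R_sum e_form_def adj_mult mult.assoc)
  also have "\<dots> = (\<Sum>(a, b)\<leftarrow>\<Delta> x. \<Sum>(r1, r2)\<leftarrow>R. \<Sum>(p1, p2)\<leftarrow>R. l (a * (S p2 * r2) * S (adj (r1 * p1) b)))"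
    by (rule trans[OF pair_sum_swap], rule pair_sum_cong, rule pair_sum_swap)
  also have "\<dots> = (\<Sum>(a, b)\<leftarrow>\<Delta> x. l (a * 1 * S (adj 1 b)))"
    by (intro pair_sum_cong R_antipode_left[of "\<lambda>u v. l (_ * v * S (adj u _))"] multilinear)
  also have "\<dots> = \<epsilon> x * l 1"
    using antipode_right_form[OF assms] by (simp add: adj_one)
  finally show ?thesis .
qed

text \<open>Moving the antipode \<open>S(h\<^sub>2)\<close> of the first action past \<open>R\<close> leaves \<open>(h\<^sub>2 \<cdot> (R\<^sup>1 \<cdot> y)) h\<^sub>3\<close>, which is
  \<open>h\<^sub>2 (R\<^sup>1 \<cdot> y)\<close>. The Nakayama automorphism then carries the remaining factor \<open>h\<^sub>1\<close> to the right end,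
  as \<open>S\<^sup>2(h\<^sub>1)\<close>, next to \<open>S(h\<^sub>2)\<close>, and \<open>\<Sum> S(h\<^sub>2) S\<^sup>2(h\<^sub>1) = S(\<Sum> S(h\<^sub>1) h\<^sub>2)\<close>.\<close>

lemma e_form_invariant:
  assumes l: "form1 l" and nak: "\<And>a z. l (z * S (S a)) = l (a * z)"
  shows "(\<Sum>(h1, h2)\<leftarrow>\<Delta> h. e_form l (adj h1 x) (adj h2 y)) = \<epsilon> h * e_form l x y"
proof -
  note [multilinear] = form1_compose[OF l]
  have "(\<Sum>(h1, h2)\<leftarrow>\<Delta> h. e_form l (adj h1 x) (adj h2 y))
      = (\<Sum>(h1, h2)\<leftarrow>\<Delta> h. \<Sum>(r1, r2)\<leftarrow>R. \<Sum>(a, b)\<leftarrow>\<Delta> h1. l (a * x * S b * r2 * S (adj r1 (adj h2 y))))"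
    unfolding e_form_def
    by (intro pair_sum_cong, subst adj_form[of "\<lambda>z. l (z * _ * _)"])
      ((intro multilinear)[1], rule refl)
  also have "\<dots> = (\<Sum>(h1, h2)\<leftarrow>\<Delta> h. \<Sum>(a, b)\<leftarrow>\<Delta> h1. \<Sum>(r1, r2)\<leftarrow>R. l (a * x * (S b * r2) * S (adj (r1 * h2) y)))"
    unfolding adj_mult mult.assoc by (intro pair_sum_cong pair_sum_swap)
  also have "\<dots> = (\<Sum>(a, h2)\<leftarrow>\<Delta> h. \<Sum>(b, c)\<leftarrow>\<Delta> h2. \<Sum>(r1, r2)\<leftarrow>R. l (a * x * (S b * r2) * S (adj (r1 * c) y)))"
    by (rule coassoc_form) (intro multilinear)
  also have "\<dots> = (\<Sum>(a, h2)\<leftarrow>\<Delta> h. \<Sum>(b, c)\<leftarrow>\<Delta> h2. \<Sum>(r1, r2)\<leftarrow>R. l (a * x * (r2 * S c) * S (adj (b * r1) y)))"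
    by (intro pair_sum_cong R_intertwines_antipode[of "\<lambda>u v. l (_ * v * S (adj u _))"] multilinear)
  also have "\<dots> = (\<Sum>(a, h2)\<leftarrow>\<Delta> h. \<Sum>(r1, r2)\<leftarrow>R. \<Sum>(b, c)\<leftarrow>\<Delta> h2. l (a * x * r2 * S (adj b (adj r1 y) * c)))"
    unfolding S_mult adj_mult mult.assoc by (intro pair_sum_cong pair_sum_swap)
  also have "\<dots> = (\<Sum>(a, h2)\<leftarrow>\<Delta> h. \<Sum>(r1, r2)\<leftarrow>R. l (a * x * r2 * S (h2 * adj r1 y)))"
    by (intro pair_sum_cong adj_mult_cancel[of "\<lambda>z. l (_ * S z)"] multilinear)
  also have "\<dots> = (\<Sum>(a, h2)\<leftarrow>\<Delta> h. \<Sum>(r1, r2)\<leftarrow>R. l (x * r2 * S (adj r1 y) * S (S a * h2)))"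
  proof (intro pair_sum_cong, goal_cases)
    case (1 a h2 r1 r2)
    show ?case
      using nak[of "x * r2 * S (adj r1 y) * S h2" a] by (simp add: S_mult mult.assoc)
  qed
  also have "\<dots> = \<epsilon> h * (\<Sum>(r1, r2)\<leftarrow>R. l (x * r2 * S (adj r1 y) * S 1))"
    by (intro antipode_left_form[of "\<lambda>z. \<Sum>(r1, r2)\<leftarrow>R. l (x * r2 * S (adj r1 y) * S z)"] multilinear)
  finally show ?thesis by (simp add: S_one e_form_def)
qed

text \<open>By invariance and \<open>(\<Delta> \<otimes> id)(R) = R\<^sup>1\<^sup>3 R\<^sup>2\<^sup>3\<close>, letting \<open>R\<^sup>1\<close> act on \<open>x\<close> and \<open>P\<^sup>1\<close> on \<open>y\<close> while keeping
  \<open>R\<^sup>2 P\<^sup>2\<close> aside has no effect. Inserting this behind \<open>S(Q\<^sup>2)\<close> cancels \<open>Q\<close> against \<open>R\<close> and leaves \<open>P\<close>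
  acting on \<open>y\<close>.\<close>

lemma e_form_transfer:
  assumes l: "form1 l" and nak: "\<And>a z. l (z * S (S a)) = l (a * z)" and F: "form1 F"
  shows "(\<Sum>(q1, q2)\<leftarrow>R. F (S q2) * e_form l (adj q1 x) y)
       = (\<Sum>(p1, p2)\<leftarrow>R. F p2 * e_form l x (adj p1 y))"
proof -
  note [multilinear] = form1_compose[OF F] form2_compose[OF form2_e_form[OF l]]
  have absorb: "(\<Sum>(r1, r2)\<leftarrow>R. \<Sum>(p1, p2)\<leftarrow>R. G (r2 * p2) * e_form l (adj r1 x) (adj p1 y)) = G 1 * e_form l x y"
    if G: "form1 G" for G x
  proof -
    note [multilinear] = form1_compose[OF G]
    have "(\<Sum>(r1, r2)\<leftarrow>R. \<Sum>(p1, p2)\<leftarrow>R. G (r2 * p2) * e_form l (adj r1 x) (adj p1 y))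
        = (\<Sum>(r1, r2)\<leftarrow>R. \<Sum>(a, b)\<leftarrow>\<Delta> r1. G r2 * e_form l (adj a x) (adj b y))"
      by (rule R_comult_left_form[symmetric]) (intro multilinear)
    also have "\<dots> = (\<Sum>(r1, r2)\<leftarrow>R. \<epsilon> r1 * (G r2 * e_form l x y))"
      by (simp only: pair_sum_mult_left e_form_invariant[OF l nak] mult.left_commute)
    also have "\<dots> = G 1 * e_form l x y"
      by (intro R_counit_left multilinear)
    finally show ?thesis .
  qed
  have "(\<Sum>(q1, q2)\<leftarrow>R. F (S q2) * e_form l (adj q1 x) y)
      = (\<Sum>(q1, q2)\<leftarrow>R. \<Sum>(r1, r2)\<leftarrow>R. \<Sum>(p1, p2)\<leftarrow>R. F (S q2 * (r2 * p2)) * e_form l (adj r1 (adj q1 x)) (adj p1 y))"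
    using absorb[of "\<lambda>z. F (S _ * z)"] by (simp add: multilinear)
  also have "\<dots> = (\<Sum>(r1, r2)\<leftarrow>R. \<Sum>(q1, q2)\<leftarrow>R. \<Sum>(p1, p2)\<leftarrow>R. F (S q2 * r2 * p2) * e_form l (adj (r1 * q1) x) (adj p1 y))"
    unfolding adj_mult mult.assoc by (rule pair_sum_swap)
  also have "\<dots> = (\<Sum>(p1, p2)\<leftarrow>R. F (1 * p2) * e_form l (adj 1 x) (adj p1 y))"
    by (rule R_antipode_left) (intro multilinear)
  finally show ?thesis by (simp add: adj_one)
qed

text \<open>Left invariance of \<open>\<lambda>\<close> at \<open>z S(c\<^sub>1)\<close>, against the form \<open>u \<mapsto> F(u c\<^sub>2)\<close>.\<close>

lemma biinvariant_antipode_shift: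
  assumes l: "biinvariant l" and F: "form1 F"
  shows "(\<Sum>(u, v)\<leftarrow>\<Delta> z. F u * l (v * S c)) = (\<Sum>(c1, c2)\<leftarrow>\<Delta> c. F c2 * l (z * S c1))"
proof -
  note [multilinear] = form1_compose[OF F] form1_compose[OF biinvariant_form[OF l]]
  have "(\<Sum>(c1, c2)\<leftarrow>\<Delta> c. F c2 * l (z * S c1)) = (\<Sum>(c1, c2)\<leftarrow>\<Delta> c. F (1 * c2) * l (z * S c1))"
    by simp
  also have "\<dots> = (\<Sum>(c1, c2)\<leftarrow>\<Delta> c. \<Sum>(u, v)\<leftarrow>\<Delta> (z * S c1). F (u * c2) * l v)"
    by (intro pair_sum_cong biinvariant_left[OF l, symmetric] multilinear)
  also have "\<dots> = (\<Sum>(c1, c2)\<leftarrow>\<Delta> c. \<Sum>(u, v)\<leftarrow>\<Delta> z. \<Sum>(a, b)\<leftarrow>\<Delta> c1. F (u * S b * c2) * l (v * S a))"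
  proof (intro pair_sum_cong, goal_cases)
    case (1 c1 c2)
    have "(\<Sum>(u, v)\<leftarrow>\<Delta> (z * S c1). F (u * c2) * l v)
        = (\<Sum>(u, v)\<leftarrow>\<Delta> z. \<Sum>(a, b)\<leftarrow>\<Delta> (S c1). F (u * a * c2) * l (v * b))"
      by (intro comult_mult_form multilinear)
    also have "\<dots> = (\<Sum>(u, v)\<leftarrow>\<Delta> z. \<Sum>(a, b)\<leftarrow>\<Delta> c1. F (u * S b * c2) * l (v * S a))"
      by (intro pair_sum_cong comult_S_form multilinear)
    finally show ?case .
  qed
  also have "\<dots> = (\<Sum>(u, v)\<leftarrow>\<Delta> z. \<Sum>(c1, c2)\<leftarrow>\<Delta> c. \<Sum>(a, b)\<leftarrow>\<Delta> c1. F (u * (S b * c2)) * l (v * S a))"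
    unfolding mult.assoc by (rule pair_sum_swap)
  also have "\<dots> = (\<Sum>(u, v)\<leftarrow>\<Delta> z. \<Sum>(a, c2)\<leftarrow>\<Delta> c. \<Sum>(b, d)\<leftarrow>\<Delta> c2. F (u * (S b * d)) * l (v * S a))"
    by (intro pair_sum_cong coassoc_form multilinear)
  also have "\<dots> = (\<Sum>(u, v)\<leftarrow>\<Delta> z. F (u * 1) * l (v * S c))"
    by (intro pair_sum_cong antipode_left_tail[of "\<lambda>a w. F (_ * w) * l (_ * S a)"] multilinear)
  finally show ?thesis by simp
qed

lemma e_form_central:
  assumes l: "biinvariant l" and nak: "\<And>a z. l (z * S (S a)) = l (a * z)" and F: "form1 F"
  shows "(\<Sum>(a, b)\<leftarrow>comult_R x. F a * e_form l b y) = (\<Sum>(a, b)\<leftarrow>comult_R y. e_form l x a * F b)"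
proof -
  note l1 = biinvariant_form[OF l]
  note [multilinear] = form1_compose[OF F] form1_compose[OF l1] form2_compose[OF form2_e_form[OF l1]]
  let ?Y = "\<lambda>r2 a b. F b * l (x * r2 * S a)"
  have "(\<Sum>(a, b)\<leftarrow>comult_R x. F a * e_form l b y)
      = (\<Sum>(a, b)\<leftarrow>\<Delta> x. \<Sum>(p1, p2)\<leftarrow>R. F (a * S p2) * e_form l (adj p1 b) y)"
    unfolding comult_R_sum by (rule pair_sum_swap)
  also have "\<dots> = (\<Sum>(a, b)\<leftarrow>\<Delta> x. \<Sum>(p1, p2)\<leftarrow>R. F (a * p2) * e_form l b (adj p1 y))"
    by (intro pair_sum_cong e_form_transfer[OF l1 nak, of "\<lambda>z. F (_ * z)"] multilinear)
  also have "\<dots> = (\<Sum>(a, b)\<leftarrow>\<Delta> x. \<Sum>(r1, r2)\<leftarrow>R. \<Sum>(p1, p2)\<leftarrow>R. F (a * p2) * l (b * r2 * S (adj (r1 * p1) y)))"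
    unfolding e_form_def adj_mult pair_sum_mult_left[symmetric] by (intro pair_sum_cong pair_sum_swap)
  also have "\<dots> = (\<Sum>(a, b)\<leftarrow>\<Delta> x. \<Sum>(r1, r2)\<leftarrow>R. \<Sum>(c, d)\<leftarrow>\<Delta> r2. F (a * c) * l (b * d * S (adj r1 y)))"
    \<comment> \<open>the copies \<open>P\<close> and \<open>R\<close> merge, so that \<open>x R\<^sup>2\<close> occurs with its whole coproduct\<close>
    by (intro pair_sum_cong R_comult_right_form[symmetric] multilinear)
  also have "\<dots> = (\<Sum>(r1, r2)\<leftarrow>R. \<Sum>(a, b)\<leftarrow>\<Delta> x. \<Sum>(c, d)\<leftarrow>\<Delta> r2. F (a * c) * l (b * d * S (adj r1 y)))"
    by (rule pair_sum_swap)
  also have "\<dots> = (\<Sum>(r1, r2)\<leftarrow>R. \<Sum>(u, v)\<leftarrow>\<Delta> (x * r2). F u * l (v * S (adj r1 y)))"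
    by (intro pair_sum_cong comult_mult_form[symmetric] multilinear)
  also have "\<dots> = (\<Sum>(r1, r2)\<leftarrow>R. \<Sum>(a, b)\<leftarrow>\<Delta> (adj r1 y). ?Y r2 a b)"
    by (intro pair_sum_cong biinvariant_antipode_shift[OF l F])
  also have "\<dots> = (\<Sum>(r1, r2)\<leftarrow>R. \<Sum>(a, b)\<leftarrow>comult_R (adj r1 y). \<Sum>(p1, p2)\<leftarrow>R. ?Y r2 (a * p2) (adj p1 b))"
    by (rule pair_sum_cong, rule comult_from_comult_R[symmetric]) (intro multilinear)
  also have "\<dots> = (\<Sum>(r1, r2)\<leftarrow>R. \<Sum>(s, t)\<leftarrow>\<Delta> r1. \<Sum>(a, b)\<leftarrow>comult_R y. \<Sum>(p1, p2)\<leftarrow>R.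
      ?Y r2 (adj s a * p2) (adj p1 (adj t b)))"
    by (rule pair_sum_cong, rule comult_R_adj) (intro multilinear)
  also have "\<dots> = (\<Sum>(r1, r2)\<leftarrow>R. \<Sum>(q1, q2)\<leftarrow>R. \<Sum>(a, b)\<leftarrow>comult_R y. \<Sum>(p1, p2)\<leftarrow>R.
      ?Y (r2 * q2) (adj r1 a * p2) (adj p1 (adj q1 b)))"
    by (rule R_comult_left_form) (intro multilinear)
  also have "\<dots> = (\<Sum>(r1, r2)\<leftarrow>R. \<Sum>(a, b)\<leftarrow>comult_R y. \<Sum>(p1, p2)\<leftarrow>R. \<Sum>(q1, q2)\<leftarrow>R.
      F (adj (p1 * q1) b) * l (x * r2 * (q2 * S p2) * S (adj r1 a)))"
    unfolding S_mult adj_mult mult.assoc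
    by (rule pair_sum_cong, rule trans[OF pair_sum_swap], rule pair_sum_cong, rule pair_sum_swap)
  also have "\<dots> = (\<Sum>(r1, r2)\<leftarrow>R. \<Sum>(a, b)\<leftarrow>comult_R y. F (adj 1 b) * l (x * r2 * 1 * S (adj r1 a)))"
    by (intro pair_sum_cong R_antipode_right[of "\<lambda>u v. F (adj u _) * l (_ * v * _)"] multilinear)
  also have "\<dots> = (\<Sum>(a, b)\<leftarrow>comult_R y. \<Sum>(r1, r2)\<leftarrow>R. l (x * r2 * S (adj r1 a)) * F b)"
    unfolding adj_one mult_1_right mult.commute[of "F _"] by (rule pair_sum_swap)
  also have "\<dots> = (\<Sum>(a, b)\<leftarrow>comult_R y. e_form l x a * F b)"
    by (simp only: e_form_def pair_sum_mult_right)
  finally show ?thesis .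
qed

end

section \<open>The braided dual\<close>

context hopf_algebra
begin

lemma vector_space_dual_scale: "vector_space (dual_scale :: 'k \<Rightarrow> ('h \<Rightarrow> 'k) \<Rightarrow> _)"
  by unfold_locales (auto simp: dual_scale_def fun_eq_iff algebra_simps)

lemma subspace_dual: "module.subspace dual_scale dual"
proof -
  interpret V: vector_space "dual_scale :: 'k \<Rightarrow> ('h \<Rightarrow> 'k) \<Rightarrow> _"
    by (rule vector_space_dual_scale)
  show ?thesis
    by (auto simp: V.subspace_def dual_scale_def form1_def algebra_simps simp flip: form1_iff_dual)
qed

lemma dual_comult_spec:
  assumes finite_dimensional and l: "form1 l"
  shows "set (dual_comult l) \<subseteq> dual \<times> dual"
    and "l (x * y) = (\<Sum>(f, g)\<leftarrow>dual_comult l. f x * g y)"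
proof -
  obtain B c where B: "finite B" "\<And>i. form1 (c i)"
    and expand: "\<And>F x. form1 F \<Longrightarrow> F x = (\<Sum>i\<in>B. c i x * F i)"
    using dual_basis[OF assms(1)] by blast
  note [multilinear] = form1_compose[OF l]
  obtain xs where xs: "set xs = B" "distinct xs"
    using finite_distinct_list[OF B(1)] by blast
  let ?ts = "map (\<lambda>i. (c i, \<lambda>y. l (i * y))) xs"
  have "l (x * y) = (\<Sum>(f, g)\<leftarrow>?ts. f x * g y)" for x y
  proof -
    have "l (x * y) = (\<Sum>i\<in>B. c i x * l (i * y))"
      by (intro expand[of "\<lambda>x. l (x * y)"] multilinear)
    then show ?thesis
      unfolding xs(1)[symmetric] sum.distinct_set_conv_list[OF xs(2)] by (simp add: o_def)
  qed
  moreover have "form1 (\<lambda>y. l (i * y))" for i by (intro multilinear)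
  then have "set ?ts \<subseteq> dual \<times> dual"
    using B(2) by (auto simp flip: form1_iff_dual)
  ultimately have "\<exists>ts. set ts \<subseteq> dual \<times> dual \<and> (\<forall>x y. l (x * y) = (\<Sum>(f, g)\<leftarrow>ts. f x * g y))"
    by blast
  from someI_ex[OF this]
  show "set (dual_comult l) \<subseteq> dual \<times> dual" "l (x * y) = (\<Sum>(f, g)\<leftarrow>dual_comult l. f x * g y)"
    unfolding dual_comult_def by blast+
qed

lemma coadj_apply: "form1 f \<Longrightarrow> (f \<triangleleft> h) x = f (adj h x)"
  by (simp add: coadj_def pair_sum_fun hit_left_def hit_right_def adj_form mult.assoc)

lemma dual_expansion:
  assumes finite_dimensional
  obtains B c where "finite B" "c ` B \<subseteq> dual" "\<And>f. f \<in> dual \<Longrightarrow> f = (\<Sum>i\<in>B. dual_scale (f i) (c i))"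
proof -
  obtain B c where B: "finite B" "\<And>i. form1 (c i)"
    and expand: "\<And>F x. form1 F \<Longrightarrow> F x = (\<Sum>i\<in>B. c i x * F i)"
    using dual_basis[OF assms(1)] by blast
  have apply_sum: "(\<Sum>i\<in>I. g i) x = (\<Sum>i\<in>I. g i x)" for g :: "'h \<Rightarrow> 'h \<Rightarrow> 'k" and I x
    by (induction I rule: infinite_finite_induct) auto
  have "f = (\<Sum>i\<in>B. dual_scale (f i) (c i))" if "f \<in> dual" for f
  proof
    fix x
    have "f x = (\<Sum>i\<in>B. c i x * f i)"
      using that by (intro expand) (simp add: form1_iff_dual)
    then show "f x = (\<Sum>i\<in>B. dual_scale (f i) (c i)) x"
      by (simp only: apply_sum dual_scale_def mult.commute)
  qed
  moreover have "c ` B \<subseteq> dual"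
    using B(2) by (auto simp flip: form1_iff_dual)
  ultimately show ?thesis using B(1) that by blast
qed

lemma dual_finite_span:
  assumes finite_dimensional
  obtains G where "finite G" "dual \<subseteq> module.span dual_scale G"
proof -
  interpret V: vector_space "dual_scale :: 'k \<Rightarrow> ('h \<Rightarrow> 'k) \<Rightarrow> _"
    by (rule vector_space_dual_scale)
  obtain B c where B: "finite B" "c ` B \<subseteq> dual"
    and expand: "\<And>f. f \<in> dual \<Longrightarrow> f = (\<Sum>i\<in>B. dual_scale (f i) (c i))"
    using dual_expansion[OF assms] by blast
  have "(\<Sum>i\<in>B. dual_scale (f i) (c i)) \<in> V.span (c ` B)" for f
    by (intro V.span_sum V.span_scale V.span_base) auto
  then have "dual \<subseteq> V.span (c ` B)"
    using expand by (metis subsetI)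
  then show ?thesis using B(1) that by blast
qed

text \<open>The coordinates on \<open>H\<^sup>*\<close> are evaluations at a basis of \<open>H\<close>, and the bilinear form gives the
  values of these coordinates on the first factor.\<close>

lemma dual_tensor_eqI:
  assumes finite_dimensional and "set ts \<subseteq> dual \<times> dual" "set us \<subseteq> dual \<times> dual"
    and eq: "\<And>x y. (\<Sum>(f, g)\<leftarrow>ts. f x * g y) = (\<Sum>(f, g)\<leftarrow>us. f x * g y)"
  shows "tensor_eq dual_scale dual (pair_words ts) (pair_words us)"
proof -
  obtain B c where B: "finite B" "c ` B \<subseteq> dual"
    and expand: "\<And>f. f \<in> dual \<Longrightarrow> f = (\<Sum>i\<in>B. dual_scale (f i) (c i))"
    using dual_expansion[OF assms(1)] by blast
  show ?thesis
    by (rule tensor_eq_coordinates[OF vector_space_dual_scale subspace_dual B expand assms(2,3)])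
      (auto simp: fun_eq_iff pair_sum_fun dual_scale_def eq)
qed

end

context quasitriangular_hopf_algebra
begin

lemma mult_R_apply: "mult_R f g h = (\<Sum>(a, b)\<leftarrow>comult_R h. f a * g b)"
  by (simp add: mult_R_def convolution_def)

lemma mult_R_dual: "f \<in> dual \<Longrightarrow> g \<in> dual \<Longrightarrow> mult_R f g \<in> dual"
proof -
  assume "f \<in> dual" "g \<in> dual"
  then have fg: "form1 f" "form1 g" by (simp_all add: form1_iff_dual)
  note [multilinear] = form1_compose[OF fg(1)] form1_compose[OF fg(2)]
  show ?thesis
    unfolding form1_iff_dual[symmetric] mult_R_apply[abs_def] by (intro multilinear)
qed

lemma mult_R_assoc:
  assumes "f \<in> dual" "g \<in> dual" "k \<in> dual"
  shows "mult_R (mult_R f g) k = mult_R f (mult_R g k)"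
proof
  fix h
  have fgk: "form1 f" "form1 g" "form1 k" using assms by (simp_all add: form1_iff_dual)
  note [multilinear] = fgk[THEN form1_compose]
  have "mult_R (mult_R f g) k h = (\<Sum>(a, b)\<leftarrow>comult_R h. \<Sum>(c, d)\<leftarrow>comult_R a. f c * g d * k b)"
    by (simp only: mult_R_apply pair_sum_mult_right)
  also have "\<dots> = (\<Sum>(a, b)\<leftarrow>comult_R h. \<Sum>(c, d)\<leftarrow>comult_R b. f a * g c * k d)"
    by (rule comult_R_coassoc) (intro multilinear)
  also have "\<dots> = mult_R f (mult_R g k) h"
    by (simp only: mult_R_apply pair_sum_mult_left mult.assoc)
  finally show "mult_R (mult_R f g) k h = mult_R f (mult_R g k) h" .
qed

lemma mult_R_unit:
  assumes "f \<in> dual"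
  shows mult_R_counit_left: "mult_R \<epsilon> f = f" and mult_R_counit_right: "mult_R f \<epsilon> = f"
  using assms comult_R_counit_left comult_R_counit_right
  by (auto simp: mult_R_apply fun_eq_iff form1_iff_dual)

lemma unital_algebra_mult_R: "unital_algebra dual_scale dual mult_R \<epsilon>"
  unfolding unital_algebra_def
proof (intro conjI ballI allI)
  show "module.subspace dual_scale dual" by (rule subspace_dual)
  show "\<epsilon> \<in> dual" using counit_form by (simp add: form1_iff_dual)
qed (auto simp: mult_R_dual mult_R_assoc mult_R_unit mult_R_apply fun_eq_iff dual_scale_def
    distrib_left distrib_right pair_sum_add mult.assoc mult.left_commute pair_sum_mult_left)

lemma hit_left_dual: "f \<in> dual \<Longrightarrow> r \<rightharpoonup> f \<in> dual"
  unfolding form1_iff_dual[symmetric] hit_left_def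
  by (erule form1_compose) (intro multilinear)

lemma dual_antipode_dual: "f \<in> dual \<Longrightarrow> dual_antipode f \<in> dual"
  unfolding form1_iff_dual[symmetric] dual_antipode_def
  by (erule form1_compose) (intro multilinear)

lemma coadj_dual: "f \<in> dual \<Longrightarrow> f \<triangleleft> r \<in> dual"
proof -
  assume "f \<in> dual"
  then have f: "form1 f" by (simp add: form1_iff_dual)
  have "form1 (\<lambda>x. f (adj r x))"
    by (rule form1_compose[OF f]) (intro multilinear)
  moreover have "f \<triangleleft> r = (\<lambda>x. f (adj r x))"
    by (rule ext) (rule coadj_apply[OF f])
  ultimately show ?thesis by (simp add: form1_iff_dual)
qed

lemma e_R_dual:
  assumes finite_dimensional "form1 l"
  shows "set (e_R l) \<subseteq> dual \<times> dual"
proof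
  fix t assume "t \<in> set (e_R l)"
  then obtain r1 r2 f g where fg: "(f, g) \<in> set (dual_comult l)"
    and t: "t = (r2 \<rightharpoonup> f, dual_antipode g \<triangleleft> r1)"
    unfolding e_R_def by auto
  from fg dual_comult_spec(1)[OF assms] have "f \<in> dual" "g \<in> dual" by blast+
  then show "t \<in> dual \<times> dual"
    unfolding t by (intro SigmaI hit_left_dual coadj_dual dual_antipode_dual)
qed

lemma e_R_form:
  assumes "finite_dimensional" "form1 l"
  shows "(\<Sum>(f, g)\<leftarrow>e_R l. f x * g y) = e_form l x y"
proof -
  have "(\<Sum>(f, g)\<leftarrow>e_R l. f x * g y)
      = (\<Sum>(r1, r2)\<leftarrow>R. \<Sum>(f, g)\<leftarrow>dual_comult l. (r2 \<rightharpoonup> f) x * (dual_antipode g \<triangleleft> r1) y)"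
    by (simp add: e_R_def sum_list_concat_pairs case_prod_unfold o_def)
  also have "\<dots> = (\<Sum>(r1, r2)\<leftarrow>R. \<Sum>(f, g)\<leftarrow>dual_comult l. f (x * r2) * g (S (adj r1 y)))"
  proof (rule pair_sum_cong, rule pair_sum_cong_set, goal_cases)
    case (1 r1 r2 f g)
    then have "dual_antipode g \<in> dual"
      using dual_comult_spec(1)[OF assms] by (blast intro: dual_antipode_dual)
    then have "(dual_antipode g \<triangleleft> r1) y = g (S (adj r1 y))"
      using coadj_apply[of "dual_antipode g" r1 y] by (simp add: form1_iff_dual dual_antipode_def)
    then show ?case by (simp add: hit_left_def)
  qed
  also have "\<dots> = e_form l x y"
    by (simp only: e_form_def dual_comult_spec(2)[OF assms])
  finally show ?thesis .
qed

lemma e_R_mult_left: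
  assumes "finite_dimensional" "form1 l"
  shows "(\<Sum>(a, b)\<leftarrow>tensor_mult mult_R [(f, \<epsilon>)] (e_R l). a x * b y)
    = (\<Sum>(a, b)\<leftarrow>comult_R x. f a * e_form l b y)"
proof -
  have "(\<Sum>(a, b)\<leftarrow>tensor_mult mult_R [(f, \<epsilon>)] (e_R l). a x * b y)
      = (\<Sum>(g, k)\<leftarrow>e_R l. mult_R f g x * mult_R \<epsilon> k y)"
    by (simp add: tensor_mult_def case_prod_unfold o_def)
  also have "\<dots> = (\<Sum>(g, k)\<leftarrow>e_R l. mult_R f g x * k y)"
    using e_R_dual[OF assms] by (intro pair_sum_cong_set) (auto simp: mult_R_counit_left)
  also have "\<dots> = (\<Sum>(g, k)\<leftarrow>e_R l. \<Sum>(a, b)\<leftarrow>comult_R x. f a * (g b * k y))"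
    by (simp only: mult_R_apply mult.assoc flip: pair_sum_mult_right)
  also have "\<dots> = (\<Sum>(a, b)\<leftarrow>comult_R x. f a * e_form l b y)"
    unfolding e_R_form[OF assms, symmetric] pair_sum_mult_left[symmetric] by (rule pair_sum_swap)
  finally show ?thesis .
qed

lemma e_R_mult_right:
  assumes "finite_dimensional" "form1 l"
  shows "(\<Sum>(a, b)\<leftarrow>tensor_mult mult_R (e_R l) [(\<epsilon>, f)]. a x * b y)
    = (\<Sum>(a, b)\<leftarrow>comult_R y. e_form l x a * f b)"
proof -
  have "(\<Sum>(a, b)\<leftarrow>tensor_mult mult_R (e_R l) [(\<epsilon>, f)]. a x * b y)
      = (\<Sum>(g, k)\<leftarrow>e_R l. mult_R g \<epsilon> x * mult_R k f y)"
    by (simp add: tensor_mult_def case_prod_unfold o_def sum_list_concat_pairs)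
  also have "\<dots> = (\<Sum>(g, k)\<leftarrow>e_R l. g x * mult_R k f y)"
    using e_R_dual[OF assms] by (intro pair_sum_cong_set) (auto simp: mult_R_counit_right)
  also have "\<dots> = (\<Sum>(g, k)\<leftarrow>e_R l. \<Sum>(a, b)\<leftarrow>comult_R y. g x * k a * f b)"
    by (simp only: mult_R_apply mult.assoc flip: pair_sum_mult_left)
  also have "\<dots> = (\<Sum>(a, b)\<leftarrow>comult_R y. e_form l x a * f b)"
    unfolding e_R_form[OF assms, symmetric] pair_sum_mult_right[symmetric] by (rule pair_sum_swap)
  finally show ?thesis .
qed

lemma e_R_sum_mult:
  assumes "finite_dimensional" "form1 l"
  shows "(\<Sum>(a, b)\<leftarrow>e_R l. mult_R a b) = dual_scale (l 1) \<epsilon>"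
proof
  fix x
  have "(\<Sum>(a, b)\<leftarrow>e_R l. mult_R a b) x = (\<Sum>(f, g)\<leftarrow>e_R l. \<Sum>(a, b)\<leftarrow>comult_R x. f a * g b)"
    by (simp only: pair_sum_fun mult_R_apply)
  also have "\<dots> = (\<Sum>(a, b)\<leftarrow>comult_R x. e_form l a b)"
    unfolding e_R_form[OF assms, symmetric] by (rule pair_sum_swap)
  also have "\<dots> = dual_scale (l 1) \<epsilon> x"
    by (simp add: e_form_mult[OF assms(2)] dual_scale_def mult.commute)
  finally show "(\<Sum>(a, b)\<leftarrow>e_R l. mult_R a b) x = dual_scale (l 1) \<epsilon> x" .
qed

lemma e_R_central:
  assumes fin: finite_dimensional and l: "biinvariant l"
    and nak: "\<And>a z. l (z * S (S a)) = l (a * z)" and f: "f \<in> dual"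
  shows "tensor_eq dual_scale dual
           (pair_words (tensor_mult mult_R [(f, \<epsilon>)] (e_R l)))
           (pair_words (tensor_mult mult_R (e_R l) [(\<epsilon>, f)]))"
proof (rule dual_tensor_eqI[OF fin])
  note l1 = biinvariant_form[OF l]
  have \<epsilon>: "\<epsilon> \<in> dual" using counit_form by (simp add: form1_iff_dual)
  show "set (tensor_mult mult_R [(f, \<epsilon>)] (e_R l)) \<subseteq> dual \<times> dual"
    "set (tensor_mult mult_R (e_R l) [(\<epsilon>, f)]) \<subseteq> dual \<times> dual"
    using e_R_dual[OF fin l1] f \<epsilon> by (auto simp: tensor_mult_def intro: mult_R_dual)
  show "(\<Sum>(a, b)\<leftarrow>tensor_mult mult_R [(f, \<epsilon>)] (e_R l). a x * b y)
      = (\<Sum>(a, b)\<leftarrow>tensor_mult mult_R (e_R l) [(\<epsilon>, f)]. a x * b y)" for x y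
    unfolding e_R_mult_left[OF fin l1] e_R_mult_right[OF fin l1]
    using e_form_central[OF l nak] f by (simp add: form1_iff_dual)
qed

end

theorem proposition3p4:
  fixes scale :: "'k::field \<Rightarrow> 'h::ring_1 \<Rightarrow> 'h"
    and \<Delta> :: "'h \<Rightarrow> ('h \<times> 'h) list"
    and \<epsilon> :: "'h \<Rightarrow> 'k"
    and S :: "'h \<Rightarrow> 'h"
    and R :: "('h \<times> 'h) list"
    and lam :: "'h \<Rightarrow> 'k"
  assumes "quasitriangular_hopf_algebra scale \<Delta> \<epsilon> S R"
    and "hopf_algebra.finite_dimensional scale"
    and "hopf_algebra.cosemisimple scale \<Delta>"
    and "hopf_algebra.unimodular scale \<epsilon>"
    and "hopf_algebra.dual_integral scale \<Delta> lam"
    and "lam 1 = 1"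
  shows "semisimple_algebra dual_scale (hopf_algebra.dual scale)
           (quasitriangular_hopf_algebra.mult_R \<Delta> S R) \<epsilon>
       \<and> (\<Sum>(a, b)\<leftarrow>quasitriangular_hopf_algebra.e_R scale \<Delta> S R lam.
            quasitriangular_hopf_algebra.mult_R \<Delta> S R a b) = \<epsilon>
       \<and> (\<forall>f\<in>hopf_algebra.dual scale.
           tensor_eq dual_scale (hopf_algebra.dual scale)
             (pair_words (tensor_mult (quasitriangular_hopf_algebra.mult_R \<Delta> S R)
                [(f, \<epsilon>)] (quasitriangular_hopf_algebra.e_R scale \<Delta> S R lam)))
             (pair_words (tensor_mult (quasitriangular_hopf_algebra.mult_R \<Delta> S R)
                (quasitriangular_hopf_algebra.e_R scale \<Delta> S R lam) [(\<epsilon>, f)])))"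
proof -
  interpret quasitriangular_hopf_algebra scale \<Delta> \<epsilon> S R by fact
  have l: "biinvariant lam"
    using assms(5,6) by (rule dual_integral_biinvariant)
  obtain \<Lambda> where \<Lambda>: "left_integral \<Lambda>" "lam \<Lambda> = 1"
    using normalized_left_integral[OF assms(2) l assms(6)] by blast
  have "right_integral \<Lambda>"
    using assms(4) \<Lambda>(1) by (auto simp: unimodular_def)
  then have nak: "lam (z * S (S a)) = lam (a * z)" for a z
    using biinvariant_nakayama[OF l \<Lambda>(1) _ \<Lambda>(2)] by blast
  have unit: "(\<Sum>(a, b)\<leftarrow>e_R lam. mult_R a b) = \<epsilon>"
    using e_R_sum_mult[OF assms(2) biinvariant_form[OF l]] assms(6) by (simp add: dual_scale_def)
  note central = e_R_central[OF assms(2) l nak]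
  obtain G where "finite G" "dual \<subseteq> module.span dual_scale G"
    using dual_finite_span[OF assms(2)] by blast
  then have "semisimple_algebra dual_scale dual mult_R \<epsilon>"
    by (rule semisimple_algebra_of_separable[OF vector_space_dual_scale unital_algebra_mult_R _ _
          e_R_dual[OF assms(2) biinvariant_form[OF l]] unit central])
  with unit central show ?thesis by blast
qed

end
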